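(* Let $\Gamma:\ell_2^0(\ell_2^{3^n})\to\ell_2(\ell_2^{3^n})$ be the Enflo-Lindenstrauss-Pisier map, $\Gamma((x_n)_n)=(\Gamma_n(x_n))_n$, where $\Gamma_n:\ell_2^{3^n}\to\ell_2^{3^n}$ are the maps defined recursively in the context, and where $\ell_2(\ell_2^{3^n})$ is identified with $\ell_2$. Then $\Gamma\,\Gamma\sim0$ in $\operatorname{Ext}^2(\ell_2,\ell_2)$ (in the category of quasi Banach spaces).
   Context: The maps $\Gamma_n$. Let $\Gamma_1,P_1:\ell_2^3\to\ell_2^3$ be $$\Gamma_1(x,y,z)=\Big(x,y,\frac{x|y|}{(|x|^2+|y|^2)^{1/2}}\Big),\qquad P_1(x,y,z)=(x,y,0).$$ Writing elements of $\ell_2^{3^n}$ as triples $(x,y,z)$ with $x,y,z\in\ell_2^{3^{n-1}}$, define for $n\ge2$ $$\Gamma_n(x,y,z)=\Big(\Gamma_{n-1}(P_{n-1}x),\ \Gamma_{n-1}(P_{n-1}y),\ \frac{P_{n-1}(x)\,\|P_{n-1}(y)\|}{(\|P_{n-1}(x)\|^2+\|P_{n-1}(y)\|^2)^{1/2}}\Big),$$ $$P_n(x,y,z)=(P_{n-1}(x),P_{n-1}(y),0),$$ with the convention that a quotient with zero denominator is $0$. $\ell_2(\ell_2^{3^n})$ is the $\ell_2$-sum of the spaces $\ell_2^{3^n}$, $n\ge1$ (a copy of $\ell_2$), and $\ell_2^0(\ell_2^{3^n})$ is its dense subspace of finitely supported elements. The map $\Gamma$ is quasilinear (Enflo-Lindenstrauss-Pisier).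 Quasi Banach spaces are complete quasinormed spaces (quasinorm: homogeneous, vanishing only at $0$, with $\|x+y\|\le C(\|x\|+\|y\|)$ for some constant $C$); operators are bounded linear maps. A sequence is exact if the kernel of each operator equals the image of the preceding one. $\operatorname{Ext}^2(X,Y)$. Consider four-term exact sequences $\mathscr E:\ 0\to Y\to E_1\to E_2\to X\to0$ of quasi Banach spaces and operators. Write $\mathscr E\to\mathscr F$ if there are operators $u_1:E_1\to F_1$, $u_2:E_2\to F_2$ that, together with the identities of $Y$ and $X$, make the obvious diagram commute. $\operatorname{Ext}^2(X,Y)$ is the set of classes for the equivalence relation generated by $\to$; its zero element is the class of $0\to Y\xrightarrow{\mathbf I}Y\xrightarrow{0}X\xrightarrow{\mathbf I}X\to0$. A sequence is trivial if it is equivalent to this one. Quasilinear maps and splicing. A homogeneous map $\Phi$ between quasinormed spaces is quasilinear if $\|\Phi(x+y)-\Phi(x)-\Phi(y)\|\le Q(\|x\|+\|y\|)$ for some $Q$ and all $x,y$. If $X,Y$ are quasi Banach, $X_0$ is dense in $X$ and $\Phi:X_0\to Y$ is quasilinear, let $Z(\Phi)$ be the completion of $Y\times X_0$ with the quasinorm $\|(y,x)\|_\Phi=\|y-\Phi(x)\|+\|x\|$. The induced exact sequence is $0\to Y\xrightarrow{\imath}Z(\Phi)\xrightarrow{\pi}X\to0$, where $\imath(y)=(y,0)$ and $\pi$ extends $(y,x)\mapsto x$. For quasilinear $\Psi:X_0\to E$ and $\Phi:E_0\to Y$ ($X_0$, $E_0$ dense in $X$, $E$), $\Phi\,\Psi$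 denotes the four-term sequence $0\to Y\to Z(\Phi)\to Z(\Psi)\to X\to0$ whose middle arrow is the composition $Z(\Phi)\to E\to Z(\Psi)$ of the quotient map and the inclusion; $\Phi\,\Psi\sim0$ means that it is trivial in $\operatorname{Ext}^2(X,Y)$. *)

theory Defs
  imports "HOL-Analysis.Analysis"
begin

text \<open>
  Scalars range over an arbitrary type of sort \<open>{real_normed_field, banach}\<close>; up to isomorphism
  the only such fields are the real and the complex numbers. Vector spaces carry an explicit
  carrier, so that one can quantify over all spaces with underlying set in a given type; the
  operations are only meaningful on the carrier.
\<close>

record ('k, 'a) qspace =
  qcar :: "'a set"
  qzero :: 'a
  qadd :: "'a \<Rightarrow> 'a \<Rightarrow> 'a"
  qsmul :: "'k \<Rightarrow> 'a \<Rightarrow> 'a"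
  qnorm :: "'a \<Rightarrow> real"

definition qdiff :: "('k::real_normed_field, 'a) qspace \<Rightarrow> 'a \<Rightarrow> 'a \<Rightarrow> 'a" where
  "qdiff V x y = qadd V x (qsmul V (- 1) y)"

definition vspace :: "('k::real_normed_field, 'a) qspace \<Rightarrow> bool" where
  "vspace V \<longleftrightarrow>
     qzero V \<in> qcar V \<and>
     (\<forall>x\<in>qcar V. \<forall>y\<in>qcar V. qadd V x y \<in> qcar V) \<and>
     (\<forall>c. \<forall>x\<in>qcar V. qsmul V c x \<in> qcar V) \<and>
     (\<forall>x\<in>qcar V. \<forall>y\<in>qcar V. \<forall>z\<in>qcar V. qadd V (qadd V x y) z = qadd V x (qadd V y z)) \<and>
     (\<forall>x\<in>qcar V. \<forall>y\<in>qcar V. qadd V x y = qadd V y x) \<and>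
     (\<forall>x\<in>qcar V. qadd V (qzero V) x = x) \<and>
     (\<forall>x\<in>qcar V. qdiff V x x = qzero V) \<and>
     (\<forall>c. \<forall>x\<in>qcar V. \<forall>y\<in>qcar V. qsmul V c (qadd V x y) = qadd V (qsmul V c x) (qsmul V c y)) \<and>
     (\<forall>c d. \<forall>x\<in>qcar V. qsmul V (c + d) x = qadd V (qsmul V c x) (qsmul V d x)) \<and>
     (\<forall>c d. \<forall>x\<in>qcar V. qsmul V (c * d) x = qsmul V c (qsmul V d x)) \<and>
     (\<forall>x\<in>qcar V. qsmul V 1 x = x)"

definition quasinormed :: "('k::real_normed_field, 'a) qspace \<Rightarrow> bool" where
  "quasinormed V \<longleftrightarrow>
     vspace V \<and>
     (\<forall>x\<in>qcar V. 0 \<le> qnorm V x) \<and>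
     (\<forall>x\<in>qcar V. qnorm V x = 0 \<longleftrightarrow> x = qzero V) \<and>
     (\<forall>c. \<forall>x\<in>qcar V. qnorm V (qsmul V c x) = norm c * qnorm V x) \<and>
     (\<exists>C. \<forall>x\<in>qcar V. \<forall>y\<in>qcar V. qnorm V (qadd V x y) \<le> C * (qnorm V x + qnorm V y))"

definition qlim :: "('k::real_normed_field, 'a) qspace \<Rightarrow> (nat \<Rightarrow> 'a) \<Rightarrow> 'a \<Rightarrow> bool" where
  "qlim V s x \<longleftrightarrow> (\<lambda>n. qnorm V (qdiff V (s n) x)) \<longlonglongrightarrow> 0"

definition qCauchy :: "('k::real_normed_field, 'a) qspace \<Rightarrow> (nat \<Rightarrow> 'a) \<Rightarrow> bool" where
  "qCauchy V s \<longleftrightarrow>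
     range s \<subseteq> qcar V \<and>
     (\<forall>e>0. \<exists>N. \<forall>m\<ge>N. \<forall>n\<ge>N. qnorm V (qdiff V (s m) (s n)) < e)"

definition quasi_banach :: "('k::real_normed_field, 'a) qspace \<Rightarrow> bool" where
  "quasi_banach V \<longleftrightarrow>
     quasinormed V \<and> (\<forall>s. qCauchy V s \<longrightarrow> (\<exists>x\<in>qcar V. qlim V s x))"

definition qlinear :: "('k, 'a) qspace \<Rightarrow> ('k, 'b) qspace \<Rightarrow> ('a \<Rightarrow> 'b) \<Rightarrow> bool" where
  "qlinear V W f \<longleftrightarrow>
     f ` qcar V \<subseteq> qcar W \<and>
     (\<forall>x\<in>qcar V. \<forall>y\<in>qcar V. f (qadd V x y) = qadd W (f x) (f y)) \<and>
     (\<forall>c. \<forall>x\<in>qcar V. f (qsmul V c x) = qsmul W c (f x))"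

definition qoperator :: "('k, 'a) qspace \<Rightarrow> ('k, 'b) qspace \<Rightarrow> ('a \<Rightarrow> 'b) \<Rightarrow> bool" where
  "qoperator V W f \<longleftrightarrow>
     qlinear V W f \<and> (\<exists>C. \<forall>x\<in>qcar V. qnorm W (f x) \<le> C * qnorm V x)"

definition qiso :: "('k, 'a) qspace \<Rightarrow> ('k, 'b) qspace \<Rightarrow> ('a \<Rightarrow> 'b) \<Rightarrow> bool" where
  "qiso V W f \<longleftrightarrow>
     bij_betw f (qcar V) (qcar W) \<and> qoperator V W f \<and> qoperator W V (inv_into (qcar V) f)"

definition isometric_iso :: "('k, 'a) qspace \<Rightarrow> ('k, 'b) qspace \<Rightarrow> ('a \<Rightarrow> 'b) \<Rightarrow> bool" where
  "isometric_iso V W f \<longleftrightarrow>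
     bij_betw f (qcar V) (qcar W) \<and> qlinear V W f \<and> (\<forall>x\<in>qcar V. qnorm W (f x) = qnorm V x)"

definition qker :: "('k, 'a) qspace \<Rightarrow> ('k, 'b) qspace \<Rightarrow> ('a \<Rightarrow> 'b) \<Rightarrow> 'a set" where
  "qker V W f = {x \<in> qcar V. f x = qzero W}"

section \<open>Four-term exact sequences\<close>

text \<open>The data of \<open>0 \<rightarrow> Y \<rightarrow> E1 \<rightarrow> E2 \<rightarrow> X \<rightarrow> 0\<close> relative to fixed \<open>Y\<close> and \<open>X\<close>.\<close>

record ('k, 'y, 'a, 'b, 'x) four_term =
  E1 :: "('k, 'a) qspace"
  E2 :: "('k, 'b) qspace"
  arr_in :: "'y \<Rightarrow> 'a"
  arr_mid :: "'a \<Rightarrow> 'b"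
  arr_out :: "'b \<Rightarrow> 'x"

definition exact4 ::
  "('k::real_normed_field, 'y) qspace \<Rightarrow> ('k, 'x) qspace \<Rightarrow> ('k, 'y, 'a, 'b, 'x) four_term \<Rightarrow> bool"
where
  "exact4 Y X S \<longleftrightarrow>
     quasi_banach Y \<and> quasi_banach (E1 S) \<and> quasi_banach (E2 S) \<and> quasi_banach X \<and>
     qoperator Y (E1 S) (arr_in S) \<and>
     qoperator (E1 S) (E2 S) (arr_mid S) \<and>
     qoperator (E2 S) X (arr_out S) \<and>
     qker Y (E1 S) (arr_in S) = {qzero Y} \<and>
     qker (E1 S) (E2 S) (arr_mid S) = arr_in S ` qcar Y \<and>
     qker (E2 S) X (arr_out S) = arr_mid S ` qcar (E1 S) \<and>
     qcar X = arr_out S ` qcar (E2 S)"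

definition commutes4 ::
  "('k, 'y) qspace \<Rightarrow> ('k, 'y, 'a, 'b, 'x) four_term \<Rightarrow> ('k, 'y, 'c, 'd, 'x) four_term
    \<Rightarrow> ('a \<Rightarrow> 'c) \<Rightarrow> ('b \<Rightarrow> 'd) \<Rightarrow> bool"
where
  "commutes4 Y S T u1 u2 \<longleftrightarrow>
     (\<forall>y\<in>qcar Y. u1 (arr_in S y) = arr_in T y) \<and>
     (\<forall>e\<in>qcar (E1 S). u2 (arr_mid S e) = arr_mid T (u1 e)) \<and>
     (\<forall>e\<in>qcar (E2 S). arr_out T (u2 e) = arr_out S e)"

definition arrow4 ::
  "('k::real_normed_field, 'y) qspace \<Rightarrow> ('k, 'x) qspace
    \<Rightarrow> ('k, 'y, 'a, 'b, 'x) four_term \<Rightarrow> ('k, 'y, 'c, 'd, 'x) four_term \<Rightarrow> bool"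
where
  "arrow4 Y X S T \<longleftrightarrow>
     exact4 Y X S \<and> exact4 Y X T \<and>
     (\<exists>u1 u2. qoperator (E1 S) (E1 T) u1 \<and> qoperator (E2 S) (E2 T) u2 \<and> commutes4 Y S T u1 u2)"

definition iso4 ::
  "('k::real_normed_field, 'y) qspace \<Rightarrow> ('k, 'x) qspace
    \<Rightarrow> ('k, 'y, 'a, 'b, 'x) four_term \<Rightarrow> ('k, 'y, 'c, 'd, 'x) four_term \<Rightarrow> bool"
where
  "iso4 Y X S T \<longleftrightarrow>
     exact4 Y X S \<and> exact4 Y X T \<and>
     (\<exists>u1 u2. qiso (E1 S) (E1 T) u1 \<and> qiso (E2 S) (E2 T) u2 \<and> commutes4 Y S T u1 u2)"

text \<open>
  The equivalence relation defining \<open>Ext\<^sup>2(X,Y)\<close>, generated by \<open>arrow4\<close> on the exact sequences whose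
  middle spaces have their underlying sets in the type \<open>'u\<close>, which plays the role of the universe.
  Sequences living on other types are compared through isomorphic copies in \<open>'u\<close>.
\<close>

definition ext2_equiv ::
  "'u itself \<Rightarrow> ('k::real_normed_field, 'y) qspace \<Rightarrow> ('k, 'x) qspace
    \<Rightarrow> ('k, 'y, 'a, 'b, 'x) four_term \<Rightarrow> ('k, 'y, 'c, 'd, 'x) four_term \<Rightarrow> bool"
where
  "ext2_equiv u Y X S T \<longleftrightarrow>
     (\<exists>S' T' :: ('k, 'y, 'u, 'u, 'x) four_term.
        iso4 Y X S S' \<and> iso4 Y X T T' \<and> equivclp (arrow4 Y X) S' T')"

definition zero4 :: "('k, 'y) qspace \<Rightarrow> ('k, 'x) qspace \<Rightarrow> ('k, 'y, 'y, 'x, 'x) four_term" where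
  "zero4 Y X =
     \<lparr>E1 = Y, E2 = X, arr_in = (\<lambda>y. y), arr_mid = (\<lambda>_. qzero X), arr_out = (\<lambda>x. x)\<rparr>"

definition ext2_trivial ::
  "'u itself \<Rightarrow> ('k::real_normed_field, 'y) qspace \<Rightarrow> ('k, 'x) qspace
    \<Rightarrow> ('k, 'y, 'a, 'b, 'x) four_term \<Rightarrow> bool"
where
  "ext2_trivial u Y X S \<longleftrightarrow> ext2_equiv u Y X S (zero4 Y X)"

section \<open>Completion, twisted sums and splicing\<close>

text \<open>
  The completion is the space of Cauchy sequences modulo null sequences, with the quotient of the
  supremum quasinorm. Since a quasinorm need not be continuous, it need not extend by continuity;
  the quotient quasinorm restricts to an equivalent quasinorm on \<open>V\<close> (and to the given one if that
  is continuous).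
\<close>

definition cclass :: "('k::real_normed_field, 'a) qspace \<Rightarrow> (nat \<Rightarrow> 'a) \<Rightarrow> (nat \<Rightarrow> 'a) set" where
  "cclass V s = {t. qCauchy V t \<and> (\<lambda>n. qnorm V (qdiff V (s n) (t n))) \<longlonglongrightarrow> 0}"

definition crep :: "(nat \<Rightarrow> 'a) set \<Rightarrow> nat \<Rightarrow> 'a" where
  "crep A = (SOME s. s \<in> A)"

definition completion :: "('k::real_normed_field, 'a) qspace \<Rightarrow> ('k, (nat \<Rightarrow> 'a) set) qspace" where
  "completion V =
     \<lparr>qcar = cclass V ` {s. qCauchy V s},
      qzero = cclass V (\<lambda>_. qzero V),
      qadd = (\<lambda>A B. cclass V (\<lambda>n. qadd V (crep A n) (crep B n))),
      qsmul = (\<lambda>c A. cclass V (\<lambda>n. qsmul V c (crep A n))),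
      qnorm = (\<lambda>A. Inf {r. \<exists>s\<in>A. \<forall>n. qnorm V (s n) \<le> r})\<rparr>"

definition twisted ::
  "('k::real_normed_field, 'y) qspace \<Rightarrow> ('k, 'x) qspace \<Rightarrow> 'x set \<Rightarrow> ('x \<Rightarrow> 'y)
    \<Rightarrow> ('k, 'y \<times> 'x) qspace"
where
  "twisted Y X X0 \<Phi> =
     \<lparr>qcar = qcar Y \<times> X0,
      qzero = (qzero Y, qzero X),
      qadd = (\<lambda>(y, x) (y', x'). (qadd Y y y', qadd X x x')),
      qsmul = (\<lambda>c (y, x). (qsmul Y c y, qsmul X c x)),
      qnorm = (\<lambda>(y, x). qnorm Y (qdiff Y y (\<Phi> x)) + qnorm X x)\<rparr>"

definition Zsp ::
  "('k::real_normed_field, 'y) qspace \<Rightarrow> ('k, 'x) qspace \<Rightarrow> 'x set \<Rightarrow> ('x \<Rightarrow> 'y)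
    \<Rightarrow> ('k, (nat \<Rightarrow> 'y \<times> 'x) set) qspace"
where
  "Zsp Y X X0 \<Phi> = completion (twisted Y X X0 \<Phi>)"

definition Zinc ::
  "('k::real_normed_field, 'y) qspace \<Rightarrow> ('k, 'x) qspace \<Rightarrow> 'x set \<Rightarrow> ('x \<Rightarrow> 'y)
    \<Rightarrow> 'y \<Rightarrow> (nat \<Rightarrow> 'y \<times> 'x) set"
where
  "Zinc Y X X0 \<Phi> y = cclass (twisted Y X X0 \<Phi>) (\<lambda>_. (y, qzero X))"

definition Zproj :: "('k::real_normed_field, 'x) qspace \<Rightarrow> (nat \<Rightarrow> 'y \<times> 'x) set \<Rightarrow> 'x" where
  "Zproj X A = (THE x. x \<in> qcar X \<and> (\<forall>s\<in>A. qlim X (\<lambda>n. snd (s n)) x))"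

text \<open>The sequence \<open>\<Phi> \<Psi>\<close> for \<open>\<Psi> : X0 \<rightarrow> E\<close> and \<open>\<Phi> : E0 \<rightarrow> Y\<close>.\<close>

definition splice4 ::
  "('k::real_normed_field, 'y) qspace \<Rightarrow> ('k, 'e) qspace \<Rightarrow> ('k, 'x) qspace
    \<Rightarrow> 'e set \<Rightarrow> ('e \<Rightarrow> 'y) \<Rightarrow> 'x set \<Rightarrow> ('x \<Rightarrow> 'e)
    \<Rightarrow> ('k, 'y, (nat \<Rightarrow> 'y \<times> 'e) set, (nat \<Rightarrow> 'e \<times> 'x) set, 'x) four_term"
where
  "splice4 Y E X E0 \<Phi> X0 \<Psi> =
     \<lparr>E1 = Zsp Y E E0 \<Phi>,
      E2 = Zsp E X X0 \<Psi>,
      arr_in = Zinc Y E E0 \<Phi>,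
      arr_mid = (\<lambda>A. Zinc E X X0 \<Psi> (Zproj E A)),
      arr_out = Zproj X\<rparr>"

section \<open>The spaces and the Enflo--Lindenstrauss--Pisier map\<close>

definition l2 :: "('k::real_normed_field, nat \<Rightarrow> 'k) qspace" where
  "l2 =
     \<lparr>qcar = {x. summable (\<lambda>n. (norm (x n))\<^sup>2)},
      qzero = (\<lambda>_. 0),
      qadd = (\<lambda>x y n. x n + y n),
      qsmul = (\<lambda>c x n. c * x n),
      qnorm = (\<lambda>x. sqrt (\<Sum>n. (norm (x n))\<^sup>2))\<rparr>"

text \<open>
  A vector of \<open>\<ell>\<^sub>2\<^sup>N\<close> is a function on \<open>nat\<close> vanishing outside \<open>{..<N}\<close>. A vector of dimension \<open>3 * m\<close>
  is the triple of its consecutive blocks of length \<open>m\<close>.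
\<close>

definition fnorm :: "nat \<Rightarrow> (nat \<Rightarrow> 'k::real_normed_field) \<Rightarrow> real" where
  "fnorm N v = L2_set (\<lambda>i. norm (v i)) {..<N}"

definition triple :: "nat \<Rightarrow> (nat \<Rightarrow> 'k) \<Rightarrow> (nat \<Rightarrow> 'k) \<Rightarrow> (nat \<Rightarrow> 'k) \<Rightarrow> nat \<Rightarrow> 'k::zero" where
  "triple m x y z =
     (\<lambda>i. if i < m then x i else if i < 2 * m then y (i - m)
          else if i < 3 * m then z (i - 2 * m) else 0)"

definition block :: "nat \<Rightarrow> nat \<Rightarrow> (nat \<Rightarrow> 'k) \<Rightarrow> nat \<Rightarrow> 'k::zero" where
  "block m k v = (\<lambda>i. if i < m then v (k * m + i) else 0)"

text \<open>
  \<open>elp_P n\<close> and \<open>elp_G n\<close> are \<open>P\<^sub>n\<close> and \<open>\<Gamma>\<^sub>n\<close> for \<open>n \<ge> 1\<close>; the value at \<open>0\<close> is irrelevant. Division by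
  zero yields zero, as the definition of \<open>\<Gamma>\<^sub>n\<close> requires.
\<close>

fun elp_P :: "nat \<Rightarrow> (nat \<Rightarrow> 'k) \<Rightarrow> nat \<Rightarrow> 'k::real_normed_field" where
  "elp_P 0 v = v"
| "elp_P (Suc 0) v = triple 1 (\<lambda>_. v 0) (\<lambda>_. v 1) (\<lambda>_. 0)"
| "elp_P (Suc (Suc n)) v =
     (let m = 3 ^ Suc n
      in triple m (elp_P (Suc n) (block m 0 v)) (elp_P (Suc n) (block m 1 v)) (\<lambda>_. 0))"

fun elp_G :: "nat \<Rightarrow> (nat \<Rightarrow> 'k) \<Rightarrow> nat \<Rightarrow> 'k::real_normed_field" where
  "elp_G 0 v = v"
| "elp_G (Suc 0) v =
     triple 1 (\<lambda>_. v 0) (\<lambda>_. v 1)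
       (\<lambda>_. (norm (v 1) / sqrt ((norm (v 0))\<^sup>2 + (norm (v 1))\<^sup>2)) *\<^sub>R v 0)"
| "elp_G (Suc (Suc n)) v =
     (let m = 3 ^ Suc n;
          x = elp_P (Suc n) (block m 0 v);
          y = elp_P (Suc n) (block m 1 v)
      in triple m (elp_G (Suc n) x) (elp_G (Suc n) y)
           (\<lambda>i. (fnorm m y / sqrt ((fnorm m x)\<^sup>2 + (fnorm m y)\<^sup>2)) *\<^sub>R x i))"

text \<open>The \<open>\<ell>\<^sub>2\<close>-sum of the spaces \<open>\<ell>\<^sub>2\<^sup>N\<close> with \<open>N = 3\<^sup>n\<close>, \<open>n \<ge> 1\<close>; the component of index \<open>0\<close> is zero.\<close>

definition elp_space :: "('k::real_normed_field, nat \<Rightarrow> nat \<Rightarrow> 'k) qspace" where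
  "elp_space =
     \<lparr>qcar = {v. (\<forall>i. v 0 i = 0) \<and> (\<forall>n i. 3 ^ n \<le> i \<longrightarrow> v n i = 0) \<and>
                 summable (\<lambda>n. (fnorm (3 ^ n) (v n))\<^sup>2)},
      qzero = (\<lambda>_ _. 0),
      qadd = (\<lambda>v w n i. v n i + w n i),
      qsmul = (\<lambda>c v n i. c * v n i),
      qnorm = (\<lambda>v. sqrt (\<Sum>n. (fnorm (3 ^ n) (v n))\<^sup>2))\<rparr>"

definition elp_space0 :: "(nat \<Rightarrow> nat \<Rightarrow> 'k::real_normed_field) set" where
  "elp_space0 = {v \<in> qcar elp_space. finite {n. v n \<noteq> (\<lambda>_. 0)}}"

definition elp_map :: "(nat \<Rightarrow> nat \<Rightarrow> 'k) \<Rightarrow> nat \<Rightarrow> nat \<Rightarrow> 'k::real_normed_field" where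
  "elp_map v = (\<lambda>n. elp_G n (v n))"

text \<open>The map read in \<open>\<ell>\<^sub>2\<close> through an identification \<open>T\<close> of the \<open>\<ell>\<^sub>2\<close>-sum with \<open>\<ell>\<^sub>2\<close>.\<close>

definition elp_dom ::
  "((nat \<Rightarrow> nat \<Rightarrow> 'k) \<Rightarrow> nat \<Rightarrow> 'k) \<Rightarrow> (nat \<Rightarrow> 'k::real_normed_field) set"
where
  "elp_dom T = T ` elp_space0"

definition elp_l2 ::
  "((nat \<Rightarrow> nat \<Rightarrow> 'k) \<Rightarrow> nat \<Rightarrow> 'k) \<Rightarrow> (nat \<Rightarrow> 'k) \<Rightarrow> nat \<Rightarrow> 'k::real_normed_field"
where
  "elp_l2 T x = T (elp_map (inv_into (qcar elp_space) T x))"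

text \<open>Such an identification exists.\<close>

lemma elp_space_isometric_l2:
  "\<exists>T :: (nat \<Rightarrow> nat \<Rightarrow> 'k::real_normed_field) \<Rightarrow> nat \<Rightarrow> 'k. isometric_iso elp_space l2 T"
proof -
  define I where "I = (SIGMA n:{1..}. {..<(3::nat) ^ n})"
  define e where "e = from_nat_into I"
  have "countable I"
    by simp
  moreover have "infinite I"
  proof
    assume "finite I"
    moreover have "(\<lambda>n. (n, 0)) ` {1::nat..} \<subseteq> I"
      by (auto simp: I_def)
    ultimately have "finite ((\<lambda>n. (n, 0::nat)) ` {1::nat..})"
      using finite_subset by blast
    then have "finite {1::nat..}"
      by (rule finite_imageD) (auto simp: inj_on_def)
    then show False
      using infinite_Ici by blast
  qed
  ultimately have e: "bij_betw e UNIV I"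
    unfolding e_def by (rule bij_betw_from_nat_into)
  have key: "(\<lambda>k. g (e k)) sums S \<longleftrightarrow> (\<lambda>n. \<Sum>i<3 ^ n. g (n, i)) sums S"
    if g: "\<And>p. 0 \<le> g p" "\<And>i. g (0, i) = 0" for g :: "nat \<times> nat \<Rightarrow> real" and S
  proof -
    let ?b = "\<lambda>n. \<Sum>i<3 ^ n. g (n, i)"
    have hs: "((\<lambda>i. g (n, i)) has_sum ?b n) {..<3 ^ n}" for n
      by (simp add: has_sum_finite)
    have "(\<lambda>k. g (e k)) sums S \<longleftrightarrow> ((\<lambda>k. g (e k)) has_sum S) UNIV"
      using has_sum_imp_sums sums_nonneg_imp_has_sum[of "\<lambda>k. g (e k)"] g(1) by blast
    also have "\<dots> \<longleftrightarrow> (g has_sum S) I"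
      by (rule has_sum_reindex_bij_betw[OF e])
    also have "\<dots> \<longleftrightarrow> (?b has_sum S) {1..}"
    proof
      assume "(g has_sum S) I"
      then show "(?b has_sum S) {1..}"
        unfolding I_def by (rule has_sum_SigmaD) (rule hs)
    next
      assume b: "(?b has_sum S) {1..}"
      then have "g summable_on I"
        unfolding I_def using g hs
        by (intro summable_on_SigmaI[where g = ?b]) (auto simp: summable_on_def)
      then show "(g has_sum S) I"
        unfolding I_def using b hs by (intro has_sum_SigmaI[where g = ?b]) auto
    qed
    also have "\<dots> \<longleftrightarrow> (?b has_sum S) UNIV"
      using g by (intro has_sum_cong_neutral) (auto simp: not_le)
    also have "\<dots> \<longleftrightarrow> ?b sums S"
      using g by (auto intro: has_sum_imp_sums sums_nonneg_imp_has_sum sum_nonneg)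
    finally show ?thesis .
  qed
  define T :: "(nat \<Rightarrow> nat \<Rightarrow> 'k) \<Rightarrow> nat \<Rightarrow> 'k" where "T v = (\<lambda>k. case_prod v (e k))" for v
  have sums: "(\<lambda>k. (norm (T v k))\<^sup>2) sums S \<longleftrightarrow> (\<lambda>n. (fnorm (3 ^ n) (v n))\<^sup>2) sums S"
    if "\<And>i. v 0 i = 0" for v S
    using key[of "\<lambda>p. (norm (case_prod v p))\<^sup>2" S] that
    by (simp add: T_def fnorm_def L2_set_def sum_nonneg)
  have summ: "summable (\<lambda>k. (norm (T v k))\<^sup>2) \<longleftrightarrow> summable (\<lambda>n. (fnorm (3 ^ n) (v n))\<^sup>2)"
    "(\<Sum>k. (norm (T v k))\<^sup>2) = (\<Sum>n. (fnorm (3 ^ n) (v n))\<^sup>2)" if "\<And>i. v 0 i = 0" for v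
    using sums[of v, OF that] by (auto simp: summable_def suminf_def)
  have bij: "bij_betw T (qcar elp_space) (qcar l2)"
  proof (rule bij_betwI')
    fix v w :: "nat \<Rightarrow> nat \<Rightarrow> 'k"
    assume vw: "v \<in> qcar elp_space" "w \<in> qcar elp_space"
    show "T v = T w \<longleftrightarrow> v = w"
    proof
      assume T: "T v = T w"
      have "v n i = w n i" for n i
      proof (cases "(n, i) \<in> I")
        case True
        then obtain k where "e k = (n, i)"
          using e by (metis bij_betw_iff_bijections)
        then show ?thesis
          using fun_cong[OF T, of k] by (simp add: T_def)
      next
        case False
        then show ?thesis
          using vw by (cases "n = 0") (auto simp: I_def elp_space_def not_less)
      qed
      then show "v = w"
        by blast
    qed simp
  next
    fix v :: "nat \<Rightarrow> nat \<Rightarrow> 'k"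
    assume "v \<in> qcar elp_space"
    then show "T v \<in> qcar l2"
      using summ(1)[of v] by (simp add: elp_space_def l2_def)
  next
    fix x :: "nat \<Rightarrow> 'k"
    assume x: "x \<in> qcar l2"
    define v where "v n i = (if (n, i) \<in> I then x (inv_into UNIV e (n, i)) else 0)" for n i
    have "T v = x"
    proof
      fix k
      have "e k \<in> I"
        using e by (auto simp: bij_betw_def)
      moreover have "inv_into UNIV e (e k) = k"
        using e by (simp add: bij_betw_def)
      ultimately show "T v k = x k"
        by (cases "e k") (simp add: T_def v_def)
    qed
    moreover have "v 0 i = 0" "3 ^ n \<le> i \<Longrightarrow> v n i = 0" for n i
      by (auto simp: v_def I_def)
    ultimately show "\<exists>v\<in>qcar elp_space. x = T v"
      using x summ(1)[of v] by (intro bexI[of _ v]) (auto simp: elp_space_def l2_def)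
  qed
  have "isometric_iso elp_space l2 T"
    unfolding isometric_iso_def qlinear_def
  proof (intro conjI ballI allI)
    show "T ` qcar elp_space \<subseteq> qcar l2"
      using bij by (simp add: bij_betw_def)
    show "qnorm l2 (T v) = qnorm elp_space v" if "v \<in> qcar elp_space" for v
      using that summ(2)[of v] by (simp add: elp_space_def l2_def)
  qed (use bij in \<open>auto simp: elp_space_def l2_def T_def fun_eq_iff split: prod.splits\<close>)
  then show ?thesis
    by blast
qed

end

theory Submission
  imports Defs
begin

text \<open>
  Let \<open>P\<close> be the norm one projection with components \<open>P\<^sub>n\<close>. Then \<open>\<Gamma> P = \<Gamma>\<close>, because \<open>\<Gamma>\<^sub>n\<close> only sees
  \<open>P\<^sub>n\<close> of its argument, and \<open>P \<Gamma> = P\<close> by induction on \<open>n\<close>. Hence \<open>(y, e) \<mapsto> (y, P e)\<close> on \<open>Z(\<Gamma>)\<close> and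
  \<open>(e, x) \<mapsto> (P e, x)\<close> from \<open>Z(\<Gamma>)\<close> to \<open>Z(P)\<close> form a morphism from \<open>\<Gamma> \<Gamma> = (\<Gamma> P) \<Gamma>\<close> to \<open>\<Gamma> (P \<Gamma>) = \<Gamma> P\<close>.
  Since \<open>P\<close> is bounded and linear, \<open>x \<mapsto> (P x, x)\<close> splits \<open>Z(P)\<close>, and so the zero sequence maps to \<open>\<Gamma> P\<close>
  as well.

  Quasilinearity of \<open>\<Gamma>\<close> follows from the bound \<open>4 (r\<^sub>1 r\<^sub>2 + r\<^sub>1 r\<^sub>3 + r\<^sub>2 r\<^sub>3)\<close> for the square of the
  defect of \<open>\<Gamma>\<^sub>n\<close>, where \<open>r\<^sub>1, r\<^sub>2, r\<^sub>3\<close> are the norms of the two arguments and of their sum. The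
  quotient in the third component of \<open>\<Gamma>\<^sub>n\<close> is the second coordinate of the normalized plane vector
  \<open>(\<parallel>x\<parallel>, \<parallel>y\<parallel>)\<close>, and the defect of this component is controlled by the Cauchy--Schwarz gaps
  \<open>\<parallel>p\<parallel> \<parallel>q\<parallel> - p \<bullet> q\<close> of three such vectors. These gaps are exactly what the bound gains in passing
  from the blocks to the whole vector, so that the induction on \<open>n\<close> closes.
\<close>

section \<open>Quasinormed spaces\<close>

lemma vspaceD:
  assumes "vspace V"
  shows vspace_zero [simp]: "qzero V \<in> qcar V"
    and vspace_add [simp]: "\<And>x y. x \<in> qcar V \<Longrightarrow> y \<in> qcar V \<Longrightarrow> qadd V x y \<in> qcar V"
    and vspace_smul [simp]: "\<And>c x. x \<in> qcar V \<Longrightarrow> qsmul V c x \<in> qcar V"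
    and vspace_diff [simp]: "\<And>x y. x \<in> qcar V \<Longrightarrow> y \<in> qcar V \<Longrightarrow> qdiff V x y \<in> qcar V"
    and vspace_assoc: "\<And>x y z. x \<in> qcar V \<Longrightarrow> y \<in> qcar V \<Longrightarrow> z \<in> qcar V \<Longrightarrow>
          qadd V (qadd V x y) z = qadd V x (qadd V y z)"
    and vspace_comm: "\<And>x y. x \<in> qcar V \<Longrightarrow> y \<in> qcar V \<Longrightarrow> qadd V x y = qadd V y x"
    and vspace_zero_left [simp]: "\<And>x. x \<in> qcar V \<Longrightarrow> qadd V (qzero V) x = x"
    and vspace_diff_self [simp]: "\<And>x. x \<in> qcar V \<Longrightarrow> qdiff V x x = qzero V"
    and vspace_smul_add: "\<And>c x y. x \<in> qcar V \<Longrightarrow> y \<in> qcar V \<Longrightarrow>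
          qsmul V c (qadd V x y) = qadd V (qsmul V c x) (qsmul V c y)"
    and vspace_add_smul: "\<And>c d x. x \<in> qcar V \<Longrightarrow>
          qsmul V (c + d) x = qadd V (qsmul V c x) (qsmul V d x)"
    and vspace_smul_smul: "\<And>c d x. x \<in> qcar V \<Longrightarrow> qsmul V (c * d) x = qsmul V c (qsmul V d x)"
    and vspace_one [simp]: "\<And>x. x \<in> qcar V \<Longrightarrow> qsmul V 1 x = x"
  using assms unfolding vspace_def by (auto simp: qdiff_def)

lemmas vspace_laws = vspace_assoc vspace_smul_add vspace_add_smul vspace_smul_smul

lemma vspace_left_comm:
  "vspace V \<Longrightarrow> x \<in> qcar V \<Longrightarrow> y \<in> qcar V \<Longrightarrow> z \<in> qcar V \<Longrightarrow>
    qadd V x (qadd V y z) = qadd V y (qadd V x z)"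
  by (metis vspace_assoc vspace_comm)

lemma vspace_zero_right [simp]: "vspace V \<Longrightarrow> x \<in> qcar V \<Longrightarrow> qadd V x (qzero V) = x"
  using vspace_comm[of V x "qzero V"] by simp

lemma vspace_smul_0 [simp]: "vspace V \<Longrightarrow> x \<in> qcar V \<Longrightarrow> qsmul V 0 x = qzero V"
  using vspace_add_smul[of V x 1 "- 1"] vspace_diff_self[of V x] by (simp add: qdiff_def)

lemma vspace_smul_zero [simp]: "vspace V \<Longrightarrow> qsmul V c (qzero V) = qzero V"
  using vspace_smul_smul[of V "qzero V" c 0] by simp

lemma vspace_diff_zero [simp]: "vspace V \<Longrightarrow> x \<in> qcar V \<Longrightarrow> qdiff V x (qzero V) = x"
  by (simp add: qdiff_def)

context
  fixes V :: "('k::real_normed_field, 'a) qspace" and x y :: 'a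
  assumes V [simp]: "vspace V" and x [simp]: "x \<in> qcar V" and y [simp]: "y \<in> qcar V"
begin

lemma vspace_diff_add_cancel: "qadd V (qdiff V x y) y = x"
proof -
  have "qadd V (qdiff V x y) y = qadd V x (qdiff V y y)"
    unfolding qdiff_def by (simp add: vspace_assoc vspace_comm[of V _ y])
  then show ?thesis
    by simp
qed

lemma vspace_diff_eq_zero: "qdiff V x y = qzero V \<longleftrightarrow> x = y"
  using vspace_diff_add_cancel by fastforce

lemma vspace_add_diff_add:
  assumes "a \<in> qcar V" "b \<in> qcar V"
  shows "qdiff V (qadd V x y) (qadd V a b) = qadd V (qdiff V x a) (qdiff V y b)"
  using assms by (simp add: qdiff_def vspace_smul_add vspace_assoc vspace_left_comm)

lemma vspace_diff_split:
  assumes "z \<in> qcar V"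
  shows "qdiff V x z = qadd V (qdiff V x y) (qdiff V y z)"
proof -
  have "qadd V (qdiff V x y) (qdiff V y z) = qadd V (qadd V (qdiff V x y) y) (qsmul V (- 1) z)"
    using assms unfolding qdiff_def[of V y z] by (simp add: vspace_assoc)
  then show ?thesis
    by (simp add: vspace_diff_add_cancel) (simp add: qdiff_def)
qed

lemma vspace_smul_diff: "qsmul V c (qdiff V x y) = qdiff V (qsmul V c x) (qsmul V c y)"
  using vspace_smul_smul[of V y c "- 1"] vspace_smul_smul[of V y "- 1" c]
  by (simp add: qdiff_def vspace_smul_add)

lemma vspace_diff_swap: "qdiff V y x = qsmul V (- 1) (qdiff V x y)"
  using vspace_smul_smul[of V y "- 1" "- 1"] by (simp add: qdiff_def vspace_smul_add vspace_comm)

lemma vspace_add_diff_self: "qdiff V (qadd V x y) x = y"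
  using vspace_add_diff_add[of x "qzero V"] by simp

end

lemma vspace_diff_diff_self:
  assumes "vspace V" "x \<in> qcar V" "y \<in> qcar V"
  shows "qdiff V x (qdiff V x y) = y"
  using vspace_add_diff_self[of V "qdiff V x y" y] vspace_diff_add_cancel[of V x y] assms by simp

lemma quasinormedD:
  assumes "quasinormed V"
  shows quasinormed_vspace [simp]: "vspace V"
    and qnorm_nonneg [simp]: "\<And>x. x \<in> qcar V \<Longrightarrow> 0 \<le> qnorm V x"
    and qnorm_eq_0: "\<And>x. x \<in> qcar V \<Longrightarrow> qnorm V x = 0 \<longleftrightarrow> x = qzero V"
    and qnorm_smul: "\<And>c x. x \<in> qcar V \<Longrightarrow> qnorm V (qsmul V c x) = norm c * qnorm V x"
  using assms unfolding quasinormed_def by auto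

lemma quasi_banach_quasinormed [simp]: "quasi_banach V \<Longrightarrow> quasinormed V"
  by (simp add: quasi_banach_def)

lemma qnorm_zero [simp]: "quasinormed V \<Longrightarrow> qnorm V (qzero V) = 0"
  by (simp add: qnorm_eq_0)

lemma quasinormedI:
  fixes V :: "('k::real_normed_field, 'a) qspace"
  assumes V: "vspace V"
    and nonneg: "\<And>x. x \<in> qcar V \<Longrightarrow> 0 \<le> qnorm V x"
    and definite: "\<And>x. x \<in> qcar V \<Longrightarrow> qnorm V x = 0 \<Longrightarrow> x = qzero V"
    and smul_le: "\<And>c x. x \<in> qcar V \<Longrightarrow> qnorm V (qsmul V c x) \<le> norm c * qnorm V x"
    and add_le: "\<And>x y. x \<in> qcar V \<Longrightarrow> y \<in> qcar V \<Longrightarrow>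
          qnorm V (qadd V x y) \<le> C * (qnorm V x + qnorm V y)"
  shows "quasinormed V"
proof -
  have zero: "qnorm V (qzero V) = 0"
    using smul_le[of "qzero V" 0] nonneg[of "qzero V"] V by simp
  have "qnorm V (qsmul V c x) = norm c * qnorm V x" if x: "x \<in> qcar V" for c x
  proof (cases "c = 0")
    case False
    have "qnorm V x = qnorm V (qsmul V (inverse c) (qsmul V c x))"
      using False x V by (simp flip: vspace_smul_smul)
    also have "\<dots> \<le> qnorm V (qsmul V c x) / norm c"
      using smul_le[of "qsmul V c x" "inverse c"] x V
      by (simp add: norm_inverse divide_inverse mult.commute)
    finally show ?thesis
      using smul_le[OF x, of c] False by (simp add: field_simps)
  qed (use x V zero in simp)
  then show ?thesis
    unfolding quasinormed_def using assms zero by blast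
qed

definition qmodulus :: "('k::real_normed_field, 'a) qspace \<Rightarrow> real" where
  "qmodulus V = (SOME C. 1 \<le> C \<and>
     (\<forall>x\<in>qcar V. \<forall>y\<in>qcar V. qnorm V (qadd V x y) \<le> C * (qnorm V x + qnorm V y)))"

context
  fixes V :: "('k::real_normed_field, 'a) qspace"
  assumes V [simp]: "quasinormed V"
begin

lemma qmodulus_ge_1: "1 \<le> qmodulus V"
  and qnorm_add_le: "x \<in> qcar V \<Longrightarrow> y \<in> qcar V \<Longrightarrow>
        qnorm V (qadd V x y) \<le> qmodulus V * (qnorm V x + qnorm V y)"
proof -
  obtain C where C: "\<And>x y. x \<in> qcar V \<Longrightarrow> y \<in> qcar V \<Longrightarrow>
      qnorm V (qadd V x y) \<le> C * (qnorm V x + qnorm V y)"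
    using V unfolding quasinormed_def by blast
  have "qnorm V (qadd V x y) \<le> max 1 C * (qnorm V x + qnorm V y)"
    if "x \<in> qcar V" "y \<in> qcar V" for x y
    using that by (intro order_trans[OF C[OF that] mult_right_mono]) auto
  then have "\<exists>C. 1 \<le> C \<and>
      (\<forall>x\<in>qcar V. \<forall>y\<in>qcar V. qnorm V (qadd V x y) \<le> C * (qnorm V x + qnorm V y))"
    by (intro exI[of _ "max 1 C"]) simp
  from someI_ex[OF this] show "1 \<le> qmodulus V"
    "x \<in> qcar V \<Longrightarrow> y \<in> qcar V \<Longrightarrow> qnorm V (qadd V x y) \<le> qmodulus V * (qnorm V x + qnorm V y)"
    unfolding qmodulus_def by auto
qed

lemma qmodulus_pos [simp]: "0 < qmodulus V"
  and qmodulus_nonneg [simp]: "0 \<le> qmodulus V"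
  and qmodulus_nonzero [simp]: "qmodulus V \<noteq> 0"
  using qmodulus_ge_1 by simp_all

lemma qnorm_add_le_bounds:
  assumes "x \<in> qcar V" "y \<in> qcar V" "qnorm V x \<le> a" "qnorm V y \<le> b"
  shows "qnorm V (qadd V x y) \<le> qmodulus V * (a + b)"
  using assms by (intro order_trans[OF qnorm_add_le mult_left_mono]) auto

lemma qnorm_diff_eq_0: "x \<in> qcar V \<Longrightarrow> y \<in> qcar V \<Longrightarrow> qnorm V (qdiff V x y) = 0 \<longleftrightarrow> x = y"
  by (simp add: qnorm_eq_0 vspace_diff_eq_zero)

lemma qnorm_diff_commute:
  "x \<in> qcar V \<Longrightarrow> y \<in> qcar V \<Longrightarrow> qnorm V (qdiff V x y) = qnorm V (qdiff V y x)"
  by (subst vspace_diff_swap) (auto simp: qnorm_smul)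

lemma qnorm_diff_triangle:
  assumes "x \<in> qcar V" "y \<in> qcar V" "z \<in> qcar V"
  shows "qnorm V (qdiff V x z) \<le> qmodulus V * (qnorm V (qdiff V x y) + qnorm V (qdiff V y z))"
  using assms by (subst vspace_diff_split[of V x y z]) (auto intro: qnorm_add_le)

lemma qnorm_le_diff:
  assumes "x \<in> qcar V" "y \<in> qcar V" "qnorm V (qdiff V x y) \<le> a" "qnorm V y \<le> b"
  shows "qnorm V x \<le> qmodulus V * (a + b)"
  using qnorm_add_le_bounds[of "qdiff V x y" y a b] assms by (simp add: vspace_diff_add_cancel)

end

section \<open>Asymptotic equality, limits and Cauchy sequences\<close>

definition qasymp ::
  "('k::real_normed_field, 'a) qspace \<Rightarrow> 'i filter \<Rightarrow> ('i \<Rightarrow> 'a) \<Rightarrow> ('i \<Rightarrow> 'a) \<Rightarrow> bool"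
where
  "qasymp V F s t \<longleftrightarrow> (\<forall>i. s i \<in> qcar V \<and> t i \<in> qcar V) \<and>
     ((\<lambda>i. qnorm V (qdiff V (s i) (t i))) \<longlongrightarrow> 0) F"

lemma qasymp_in:
  assumes "qasymp V F s t"
  shows qasymp_in_left: "s i \<in> qcar V" and qasymp_in_right: "t i \<in> qcar V"
  using assms by (auto simp: qasymp_def)

lemma qasymp_tendsto: "qasymp V F s t \<Longrightarrow> ((\<lambda>i. qnorm V (qdiff V (s i) (t i))) \<longlongrightarrow> 0) F"
  by (simp add: qasymp_def)

lemma qasymp_compose:
  "qasymp V F s t \<Longrightarrow> filterlim h F G \<Longrightarrow> qasymp V G (\<lambda>i. s (h i)) (\<lambda>i. t (h i))"
  unfolding qasymp_def using filterlim_compose by fastforce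

lemma qCauchy_in: "qCauchy V s \<Longrightarrow> s n \<in> qcar V"
  by (auto simp: qCauchy_def)

lemma quasi_banach_iff:
  "quasi_banach V \<longleftrightarrow>
     quasinormed V \<and> (\<forall>s. qCauchy V s \<longrightarrow> (\<exists>x. qasymp V sequentially s (\<lambda>_. x)))"
proof -
  have "(\<exists>x\<in>qcar V. qlim V s x) \<longleftrightarrow> (\<exists>x. qasymp V sequentially s (\<lambda>_. x))" if "qCauchy V s" for s
    using qCauchy_in[OF that] by (auto simp: qlim_def qasymp_def)
  then show ?thesis
    unfolding quasi_banach_def by blast
qed

lemma quasi_banach_complete:
  assumes "quasi_banach V" "qCauchy V s"
  obtains x where "qasymp V sequentially s (\<lambda>_. x)"
  using assms by (auto simp: quasi_banach_iff)

context
  fixes V :: "('k::real_normed_field, 'a) qspace"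
  assumes V [simp]: "quasinormed V"
begin

lemma qasympI:
  assumes in_V [simp]: "\<And>i. s i \<in> qcar V" "\<And>i. t i \<in> qcar V"
    and bound: "\<And>i. qnorm V (qdiff V (s i) (t i)) \<le> g i" and null: "(g \<longlongrightarrow> 0) F"
  shows "qasymp V F s t"
  unfolding qasymp_def
  using tendsto_sandwich[OF always_eventually always_eventually tendsto_const null] bound by simp

lemma qasymp_refl: "(\<And>i. s i \<in> qcar V) \<Longrightarrow> qasymp V F s s"
  by (simp add: qasymp_def)

lemma qasymp_sym: "qasymp V F s t \<Longrightarrow> qasymp V F t s"
  using qnorm_diff_commute[OF V] by (simp add: qasymp_def)

lemma qasymp_trans:
  assumes st: "qasymp V F s t" and tu: "qasymp V F t u"
  shows "qasymp V F s u"
proof (rule qasympI)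
  note in_V = qasymp_in[OF st] qasymp_in[OF tu]
  show "qnorm V (qdiff V (s i) (u i))
      \<le> qmodulus V * (qnorm V (qdiff V (s i) (t i)) + qnorm V (qdiff V (t i) (u i)))" for i
    by (intro qnorm_diff_triangle V in_V)
  show "((\<lambda>i. qmodulus V * (qnorm V (qdiff V (s i) (t i)) + qnorm V (qdiff V (t i) (u i)))) \<longlongrightarrow> 0) F"
    using st tu by (intro tendsto_mult_right_zero tendsto_add_zero qasymp_tendsto)
qed (use assms in \<open>auto intro: qasymp_in\<close>)

lemma qasymp_add:
  assumes st: "qasymp V F s t" and uv: "qasymp V F u v"
  shows "qasymp V F (\<lambda>i. qadd V (s i) (u i)) (\<lambda>i. qadd V (t i) (v i))"
proof (rule qasympI)
  note in_V = qasymp_in[OF st] qasymp_in[OF uv]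
  show "qnorm V (qdiff V (qadd V (s i) (u i)) (qadd V (t i) (v i)))
      \<le> qmodulus V * (qnorm V (qdiff V (s i) (t i)) + qnorm V (qdiff V (u i) (v i)))" for i
    using in_V by (simp add: vspace_add_diff_add qnorm_add_le)
  show "((\<lambda>i. qmodulus V * (qnorm V (qdiff V (s i) (t i)) + qnorm V (qdiff V (u i) (v i)))) \<longlongrightarrow> 0) F"
    using st uv by (intro tendsto_mult_right_zero tendsto_add_zero qasymp_tendsto)
qed (use qasymp_in[OF st] qasymp_in[OF uv] in simp_all)

lemma qasymp_smul:
  assumes "qasymp V F s t"
  shows "qasymp V F (\<lambda>i. qsmul V c (s i)) (\<lambda>i. qsmul V c (t i))"
proof (rule qasympI)
  show "qnorm V (qdiff V (qsmul V c (s i)) (qsmul V c (t i)))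
      \<le> norm c * qnorm V (qdiff V (s i) (t i))" for i
    using qasymp_in[OF assms] by (simp add: qnorm_smul flip: vspace_smul_diff)
  show "((\<lambda>i. norm c * qnorm V (qdiff V (s i) (t i))) \<longlongrightarrow> 0) F"
    using assms by (intro tendsto_mult_right_zero qasymp_tendsto)
qed (use qasymp_in[OF assms] in simp_all)

lemma qasymp_const_iff:
  assumes "x \<in> qcar V" "y \<in> qcar V" "F \<noteq> bot"
  shows "qasymp V F (\<lambda>_. x) (\<lambda>_. y) \<longleftrightarrow> x = y"
  using assms by (simp add: qasymp_def tendsto_const_iff qnorm_diff_eq_0)

lemma qasymp_limit_unique:
  assumes x: "qasymp V F s (\<lambda>_. x)" and y: "qasymp V F s (\<lambda>_. y)" and F: "F \<noteq> bot"
  shows "x = y"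
  using qasymp_trans[OF qasymp_sym[OF x] y]
  by (rule qasymp_const_iff[OF qasymp_in_right[OF x] qasymp_in_right[OF y] F, THEN iffD1])

lemma qasymp_limit_qnorm_le:
  \<comment> \<open>The modulus is needed because a quasinorm need not be continuous.\<close>
  assumes s: "qasymp V F s (\<lambda>_. x)" and r: "\<And>i. qnorm V (s i) \<le> r" and F: "F \<noteq> bot"
  shows "qnorm V x \<le> qmodulus V * r"
proof (rule tendsto_lowerbound)
  show "((\<lambda>i. qmodulus V * (qnorm V (qdiff V x (s i)) + r)) \<longlongrightarrow> qmodulus V * r) F"
    by (auto intro!: tendsto_eq_intros qasymp_tendsto[OF qasymp_sym[OF s]])
  show "\<forall>\<^sub>F i in F. qnorm V x \<le> qmodulus V * (qnorm V (qdiff V x (s i)) + r)"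
    using qasymp_in[OF s] r by (intro always_eventually allI qnorm_le_diff[OF V _ _ order_refl]) auto
qed (use F in auto)

lemma qCauchy_iff_qasymp:
  "qCauchy V s \<longleftrightarrow> qasymp V (sequentially \<times>\<^sub>F sequentially) (\<lambda>p. s (fst p)) (\<lambda>p. s (snd p))"
proof (cases "range s \<subseteq> qcar V")
  case True
  then have [simp]: "s n \<in> qcar V" for n
    by blast
  have "qnorm V (qdiff V (s m) (s n)) = qnorm V (qdiff V (s n) (s m))" for m n
    by (simp add: qnorm_diff_commute[of V])
  then show ?thesis
    by (simp add: qCauchy_def qasymp_def tendsto_iff eventually_prod_sequentially image_subset_iff)
next
  case False
  then show ?thesis
    by (force simp: qCauchy_def qasymp_def)
qed

lemma qCauchy_const: "x \<in> qcar V \<Longrightarrow> qCauchy V (\<lambda>_. x)"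
  by (simp add: qCauchy_iff_qasymp qasymp_refl)

lemma qCauchy_add: "qCauchy V s \<Longrightarrow> qCauchy V t \<Longrightarrow> qCauchy V (\<lambda>n. qadd V (s n) (t n))"
  and qCauchy_smul: "qCauchy V s \<Longrightarrow> qCauchy V (\<lambda>n. qsmul V c (s n))"
  by (simp_all add: qCauchy_iff_qasymp qasymp_add qasymp_smul)

lemma qCauchy_diff: "qCauchy V s \<Longrightarrow> qCauchy V t \<Longrightarrow> qCauchy V (\<lambda>n. qdiff V (s n) (t n))"
  by (simp add: qdiff_def qCauchy_add qCauchy_smul)

lemma qasymp_qCauchy:
  assumes st: "qasymp V sequentially s t" and s: "qCauchy V s"
  shows "qCauchy V t"
proof -
  let ?F = "sequentially \<times>\<^sub>F sequentially :: (nat \<times> nat) filter"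
  have "qasymp V ?F (\<lambda>p. t (fst p)) (\<lambda>p. s (fst p))" "qasymp V ?F (\<lambda>p. s (snd p)) (\<lambda>p. t (snd p))"
    using qasymp_compose[OF qasymp_sym[OF st] filterlim_fst] qasymp_compose[OF st filterlim_snd] .
  with s show ?thesis
    unfolding qCauchy_iff_qasymp using qasymp_trans by blast
qed

lemma qCauchy_shift:
  assumes "qCauchy V s"
  shows "qasymp V sequentially s (\<lambda>n. s (n + N))"
proof -
  have "filterlim (\<lambda>n. (n, n + N)) (sequentially \<times>\<^sub>F sequentially) sequentially"
    by (intro filterlim_Pair filterlim_ident filterlim_add_const_nat_at_top)
  from qasymp_compose[OF assms[unfolded qCauchy_iff_qasymp] this] show ?thesis
    by simp
qed

lemma qCauchy_bounded:
  assumes s: "qCauchy V s"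
  obtains r where "\<forall>\<^sub>F n in sequentially. qnorm V (s n) \<le> r"
proof -
  obtain N where "\<forall>n\<ge>N. qnorm V (qdiff V (s n) (s N)) < 1"
    using s unfolding qCauchy_def by (meson order_refl zero_less_one)
  then have "qnorm V (s n) \<le> qmodulus V * (1 + qnorm V (s N))" if "n \<ge> N" for n
    using that by (intro qnorm_le_diff[OF V]) (auto intro: less_imp_le qCauchy_in[OF s])
  then show ?thesis
    using that by (auto simp: eventually_sequentially)
qed

lemma qCauchyI_tail_bound:
  assumes w [simp]: "\<And>n. w n \<in> qcar V"
    and tail: "\<And>n p. qnorm V (qdiff V (w (n + p)) (w n)) \<le> b n" and null: "b \<longlonglongrightarrow> 0"
  shows "qCauchy V w"
  unfolding qCauchy_def
proof (intro conjI allI impI)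
  fix e :: real assume "0 < e"
  then obtain N where N: "\<And>n. n \<ge> N \<Longrightarrow> b n < e"
    using order_tendstoD(2)[OF null] by (auto simp: eventually_sequentially)
  have ordered: "qnorm V (qdiff V (w m) (w n)) < e" if "N \<le> n" "n \<le> m" for m n
    using tail[of n "m - n"] N[of n] that by simp
  then have "qnorm V (qdiff V (w m) (w n)) < e" if "N \<le> m" "N \<le> n" for m n
    using that ordered[of n m] ordered[of m n] qnorm_diff_commute[OF V w w, of m n]
    by (cases "n \<le> m") simp_all
  then show "\<exists>N. \<forall>m\<ge>N. \<forall>n\<ge>N. qnorm V (qdiff V (w m) (w n)) < e"
    by blast
qed auto

lemma qCauchy_geometric:
  assumes w [simp]: "\<And>n. w n \<in> qcar V" and r: "r = 1 / (2 * qmodulus V)"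
    and step: "\<And>n. qnorm V (qdiff V (w (Suc n)) (w n)) \<le> M * r ^ n"
  shows "qCauchy V w"
proof (rule qCauchyI_tail_bound[where b = "\<lambda>n. 2 * qmodulus V * M * r ^ n"])
  let ?K = "qmodulus V"
  have r_K: "2 * ?K * r = 1" and r_pos: "0 < r" and r_less: "r < 1"
    using qmodulus_ge_1[OF V] unfolding r by simp_all
  show "qnorm V (qdiff V (w (n + p)) (w n)) \<le> 2 * ?K * M * r ^ n" for n p
  proof (induction p arbitrary: n)
    case 0
    have "0 \<le> qnorm V (qdiff V (w 1) (w 0))"
      by simp
    also have "\<dots> \<le> M"
      using step[of 0] by simp
    finally show ?case
      using r_pos by simp
  next
    case (Suc p)
    have "qnorm V (qdiff V (w (n + Suc p)) (w n))
        \<le> ?K * (qnorm V (qdiff V (w (Suc n + p)) (w (Suc n))) + qnorm V (qdiff V (w (Suc n)) (w n)))"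
      using qnorm_diff_triangle[of V "w (Suc n + p)" "w (Suc n)" "w n"] by simp
    also have "\<dots> \<le> ?K * (2 * ?K * M * r ^ Suc n + M * r ^ n)"
      by (intro mult_left_mono add_mono Suc.IH step qmodulus_nonneg V)
    also have "\<dots> = ?K * ((2 * ?K * r) * (M * r ^ n) + M * r ^ n)"
      by (simp add: algebra_simps)
    finally show ?case
      unfolding r_K by (simp add: algebra_simps)
  qed
  have "(\<lambda>n. 2 * ?K * M * r ^ n) \<longlonglongrightarrow> 2 * ?K * M * 0"
    using r_pos r_less by (intro tendsto_intros LIMSEQ_power_zero) auto
  then show "(\<lambda>n. 2 * ?K * M * r ^ n) \<longlonglongrightarrow> 0"
    by simp
qed simp

end

section \<open>Operators\<close>

lemma qlinearD:
  assumes "qlinear V W f"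
  shows qlinear_in: "\<And>x. x \<in> qcar V \<Longrightarrow> f x \<in> qcar W"
    and qlinear_add: "\<And>x y. x \<in> qcar V \<Longrightarrow> y \<in> qcar V \<Longrightarrow> f (qadd V x y) = qadd W (f x) (f y)"
    and qlinear_smul: "\<And>c x. x \<in> qcar V \<Longrightarrow> f (qsmul V c x) = qsmul W c (f x)"
  using assms unfolding qlinear_def by auto

lemma qlinear_diff:
  assumes "qlinear V W f" "vspace V" "x \<in> qcar V" "y \<in> qcar V"
  shows "f (qdiff V x y) = qdiff W (f x) (f y)"
  using assms by (simp add: qdiff_def qlinear_add qlinear_smul)

lemma qlinear_zero:
  assumes "qlinear V W f" "vspace V" "vspace W"
  shows "f (qzero V) = qzero W"
  using assms qlinear_smul[of V W f "qzero V" 0] qlinear_in[of V W f "qzero V"] by simp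

lemma qoperator_qlinear: "qoperator V W f \<Longrightarrow> qlinear V W f"
  by (simp add: qoperator_def)

lemmas qoperator_in = qlinear_in[OF qoperator_qlinear]
lemmas qoperator_add = qlinear_add[OF qoperator_qlinear]
lemmas qoperator_smul = qlinear_smul[OF qoperator_qlinear]
lemmas qoperator_diff = qlinear_diff[OF qoperator_qlinear]
lemmas qoperator_zero = qlinear_zero[OF qoperator_qlinear]

lemma qoperator_bound:
  assumes "qoperator V W f" "quasinormed V"
  obtains C where "0 \<le> C" "\<And>x. x \<in> qcar V \<Longrightarrow> qnorm W (f x) \<le> C * qnorm V x"
proof -
  obtain C where C: "\<And>x. x \<in> qcar V \<Longrightarrow> qnorm W (f x) \<le> C * qnorm V x"
    using assms(1) unfolding qoperator_def by blast
  have "qnorm W (f x) \<le> max 0 C * qnorm V x" if "x \<in> qcar V" for x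
    using that assms(2) by (intro order_trans[OF C mult_right_mono]) auto
  then show ?thesis
    using that[of "max 0 C"] by auto
qed

lemma qoperatorI:
  assumes "\<And>x. x \<in> qcar V \<Longrightarrow> f x \<in> qcar W"
    and "\<And>x y. x \<in> qcar V \<Longrightarrow> y \<in> qcar V \<Longrightarrow> f (qadd V x y) = qadd W (f x) (f y)"
    and "\<And>c x. x \<in> qcar V \<Longrightarrow> f (qsmul V c x) = qsmul W c (f x)"
    and "\<And>x. x \<in> qcar V \<Longrightarrow> qnorm W (f x) \<le> C * qnorm V x"
  shows "qoperator V W f"
  using assms unfolding qoperator_def qlinear_def by blast

lemma qoperator_id: "qoperator V V (\<lambda>x. x)"
  by (rule qoperatorI[where C = 1]) auto

lemma qoperator_const_zero: "quasinormed V \<Longrightarrow> quasinormed W \<Longrightarrow> qoperator V W (\<lambda>_. qzero W)"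
  by (rule qoperatorI[where C = 0]) auto

lemma qoperator_comp:
  assumes f: "qoperator V W f" and g: "qoperator W U g" and V: "quasinormed V" and W: "quasinormed W"
  shows "qoperator V U (\<lambda>x. g (f x))"
proof -
  obtain A where A: "\<And>x. x \<in> qcar V \<Longrightarrow> qnorm W (f x) \<le> A * qnorm V x"
    using qoperator_bound[OF f V] by blast
  obtain B where B: "0 \<le> B" "\<And>x. x \<in> qcar W \<Longrightarrow> qnorm U (g x) \<le> B * qnorm W x"
    using qoperator_bound[OF g W] by blast
  show ?thesis
  proof (rule qoperatorI)
    show "qnorm U (g (f x)) \<le> (B * A) * qnorm V x" if x: "x \<in> qcar V" for x
      using B(2)[OF qoperator_in[OF f x]] mult_left_mono[OF A[OF x] B(1)] by (simp add: mult.assoc)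
  qed (use f g in \<open>auto simp: qoperator_in qoperator_add qoperator_smul\<close>)
qed

lemma qoperator_qasymp:
  assumes f: "qoperator V W f" and V: "quasinormed V" "quasinormed W" and st: "qasymp V F s t"
  shows "qasymp W F (\<lambda>i. f (s i)) (\<lambda>i. f (t i))"
proof -
  note in_V = qasymp_in[OF st]
  obtain C where C: "\<And>x. x \<in> qcar V \<Longrightarrow> qnorm W (f x) \<le> C * qnorm V x"
    using qoperator_bound[OF f V(1)] by blast
  show ?thesis
  proof (rule qasympI[OF V(2)])
    show "qnorm W (qdiff W (f (s i)) (f (t i))) \<le> C * qnorm V (qdiff V (s i) (t i))" for i
      using C[of "qdiff V (s i) (t i)"] in_V V by (simp add: qoperator_diff[OF f])
    show "((\<lambda>i. C * qnorm V (qdiff V (s i) (t i))) \<longlongrightarrow> 0) F"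
      by (intro tendsto_mult_right_zero qasymp_tendsto st)
  qed (auto intro: qoperator_in[OF f] in_V)
qed

lemma qoperator_qCauchy:
  assumes "qoperator V W f" "quasinormed V" "quasinormed W" "qCauchy V s"
  shows "qCauchy W (\<lambda>n. f (s n))"
  using qoperator_qasymp[OF assms(1-3)] assms by (simp add: qCauchy_iff_qasymp)

lemma bounded_below_qasymp:
  assumes f: "qlinear V W f" and V: "quasinormed V"
    and bounded_below: "\<And>x. x \<in> qcar V \<Longrightarrow> qnorm V x \<le> C * qnorm W (f x)"
    and in_V: "\<And>i. s i \<in> qcar V" "\<And>i. t i \<in> qcar V"
    and st: "qasymp W F (\<lambda>i. f (s i)) (\<lambda>i. f (t i))"
  shows "qasymp V F s t"
proof (rule qasympI[OF V in_V])
  show "qnorm V (qdiff V (s i) (t i)) \<le> C * qnorm W (qdiff W (f (s i)) (f (t i)))" for i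
    using bounded_below[of "qdiff V (s i) (t i)"] V in_V by (simp add: qlinear_diff[OF f])
  show "((\<lambda>i. C * qnorm W (qdiff W (f (s i)) (f (t i)))) \<longlongrightarrow> 0) F"
    by (intro tendsto_mult_right_zero qasymp_tendsto st)
qed

lemma bounded_below_qCauchy:
  assumes "qlinear V W f" "quasinormed V" "quasinormed W"
    and "\<And>x. x \<in> qcar V \<Longrightarrow> qnorm V x \<le> C * qnorm W (f x)"
    and "\<And>n. s n \<in> qcar V" "qCauchy W (\<lambda>n. f (s n))"
  shows "qCauchy V s"
  using bounded_below_qasymp[of V W f C "\<lambda>p. s (fst p)" "\<lambda>p. s (snd p)"] assms
  by (simp add: qCauchy_iff_qasymp)

lemma isometric_isoD:
  assumes "isometric_iso V W f"
  shows isometric_iso_image: "f ` qcar V = qcar W"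
    and isometric_iso_inv: "\<And>x. x \<in> qcar V \<Longrightarrow> inv_into (qcar V) f (f x) = x"
    and isometric_iso_norm: "\<And>x. x \<in> qcar V \<Longrightarrow> qnorm W (f x) = qnorm V x"
    and isometric_iso_qoperator: "qoperator V W f"
  using assms by (auto simp: isometric_iso_def bij_betw_def qoperator_def intro: exI[of _ 1])

lemma isometric_iso_inverse:
  assumes f: "isometric_iso V W f" and V: "vspace V"
  shows "isometric_iso W V (inv_into (qcar V) f)"
proof -
  note op = isometric_iso_qoperator[OF f]
  have "inv_into (qcar V) f (qadd W (f x) (f y)) = qadd V x y"
    "inv_into (qcar V) f (qsmul W c (f x)) = qsmul V c x" if "x \<in> qcar V" "y \<in> qcar V" for x y c
    using that V isometric_iso_inv[OF f] by (simp_all flip: qoperator_add[OF op] qoperator_smul[OF op])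
  moreover have "bij_betw (inv_into (qcar V) f) (qcar W) (qcar V)"
    using f by (simp add: isometric_iso_def bij_betw_inv_into)
  ultimately show ?thesis
    using isometric_iso_inv[OF f] isometric_iso_norm[OF f]
    by (auto simp: isometric_iso_def qlinear_def simp flip: isometric_iso_image[OF f])
qed

lemma isometric_iso_qiso: "isometric_iso V W f \<Longrightarrow> vspace V \<Longrightarrow> qiso V W f"
  unfolding qiso_def
  using isometric_iso_inverse[of V W f] by (auto simp: isometric_iso_qoperator isometric_iso_def[of V W f])

lemma quasi_banach_isometric:
  assumes iso: "isometric_iso V W f" and zero: "f (qzero V) = qzero W" and V: "quasi_banach V"
  shows "quasi_banach W"
proof -
  note W = isometric_iso_image[OF iso, symmetric] and f_norm = isometric_iso_norm[OF iso]
    and f = isometric_iso_qoperator[OF iso]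
  have [simp]: "quasinormed V" "vspace V"
    using V by simp_all
  have [simp]: "qadd W (f x) (f y) = f (qadd V x y)" "qsmul W c (f x) = f (qsmul V c x)"
    "qdiff W (f x) (f y) = f (qdiff V x y)" if "x \<in> qcar V" "y \<in> qcar V" for x y c
    using that by (simp_all add: qoperator_add[OF f] qoperator_smul[OF f] qoperator_diff[OF f])
  have quasinormed: "quasinormed W"
  proof (rule quasinormedI[where C = "qmodulus V"])
    show "vspace W"
      unfolding vspace_def W zero[symmetric]
      by (auto simp: vspace_laws intro: arg_cong[where f = f] vspace_comm[OF \<open>vspace V\<close>])
  qed (auto simp: W f_norm qnorm_smul qnorm_eq_0 zero qnorm_add_le)
  have "\<exists>x. qasymp W sequentially s (\<lambda>_. x)" if s: "qCauchy W s" for s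
  proof -
    define t where "t n = inv_into (qcar V) f (s n)" for n
    have t: "t n \<in> qcar V" and f_t: "f (t n) = s n" for n
      using qCauchy_in[OF s, of n] by (simp_all add: t_def W inv_into_into f_inv_into_f)
    have "qCauchy V t"
      by (rule bounded_below_qCauchy[OF qoperator_qlinear[OF f], where C = 1])
        (simp_all add: quasinormed t f_t f_norm s)
    then obtain x where x: "qasymp V sequentially t (\<lambda>_. x)"
      using quasi_banach_complete[OF V] by blast
    from qoperator_qasymp[OF f _ quasinormed x]
    have "qasymp W sequentially s (\<lambda>_. f x)"
      by (simp add: f_t)
    then show ?thesis ..
  qed
  with quasinormed show ?thesis
    by (simp add: quasi_banach_iff)
qed

section \<open>Completions\<close>

lemma le_affine_if_le_above:
  fixes a b c d :: real
  assumes "\<And>r. a < r \<Longrightarrow> b \<le> c * r + d"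
  shows "b \<le> c * a + d"
proof (rule tendsto_lowerbound)
  show "((\<lambda>r. c * r + d) \<longlongrightarrow> c * a + d) (at_right a)"
    by (intro tendsto_intros)
  show "\<forall>\<^sub>F r in at_right a. b \<le> c * r + d"
    using assms by (auto simp: eventually_at_filter)
qed simp

definition cemb :: "('k::real_normed_field, 'a) qspace \<Rightarrow> 'a \<Rightarrow> (nat \<Rightarrow> 'a) set" where
  "cemb V v = cclass V (\<lambda>_. v)"

context
  fixes V :: "('k::real_normed_field, 'a) qspace"
  assumes V [simp]: "quasinormed V"
begin

lemma mem_cclass_iff:
  assumes "qCauchy V s"
  shows "t \<in> cclass V s \<longleftrightarrow> qasymp V sequentially s t"
  using qasymp_qCauchy[OF V _ assms, of t] qCauchy_in[OF assms] qCauchy_in[of V t]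
  by (auto simp: cclass_def qasymp_def)

lemma cclass_self: "qCauchy V s \<Longrightarrow> s \<in> cclass V s"
  by (simp add: mem_cclass_iff qasymp_refl qCauchy_in)

lemma cclass_eq_iff:
  assumes s: "qCauchy V s" and t: "qCauchy V t"
  shows "cclass V s = cclass V t \<longleftrightarrow> qasymp V sequentially s t"
proof
  show "qasymp V sequentially s t" if "cclass V s = cclass V t"
    using cclass_self[OF t] s that by (metis mem_cclass_iff)
  show "cclass V s = cclass V t" if "qasymp V sequentially s t"
    using that qasymp_sym[OF V that] qasymp_trans[OF V] by (auto simp: mem_cclass_iff s t)
qed

lemma cclass_in: "qCauchy V s \<Longrightarrow> cclass V s \<in> qcar (completion V)"
  by (simp add: completion_def)

lemma completion_mem:
  assumes A: "A \<in> qcar (completion V)" and s: "s \<in> A"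
  shows "qCauchy V s" "cclass V s = A"
proof -
  obtain t where t: "qCauchy V t" "A = cclass V t"
    using A by (auto simp: completion_def)
  with s have ts: "qasymp V sequentially t s"
    by (simp add: mem_cclass_iff)
  then show "qCauchy V s"
    by (rule qasymp_qCauchy[OF V _ t(1)])
  then show "cclass V s = A"
    using t ts by (metis cclass_eq_iff)
qed

lemma crep_in:
  assumes "A \<in> qcar (completion V)"
  shows "crep A \<in> A"
proof -
  have "\<exists>s. s \<in> A"
    using assms cclass_self by (auto simp: completion_def)
  then show ?thesis
    unfolding crep_def by (rule someI_ex)
qed

lemma crep_cclass:
  assumes "qCauchy V s"
  shows "qCauchy V (crep (cclass V s))" "qasymp V sequentially s (crep (cclass V s))"
  using crep_in[OF cclass_in[OF assms]] completion_mem(1)[OF cclass_in[OF assms]] assms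
  by (auto simp: mem_cclass_iff)

lemma completion_cases:
  assumes "A \<in> qcar (completion V)"
  obtains s where "qCauchy V s" "A = cclass V s"
  using completion_mem[OF assms crep_in[OF assms]] by metis

lemma inj_on_crep: "inj_on crep (qcar (completion V))"
  by (rule inj_onI) (metis completion_mem(2) crep_in)

lemma completion_zero: "qzero (completion V) = cclass V (\<lambda>_. qzero V)"
  by (simp add: completion_def)

lemma completion_add:
  assumes s: "qCauchy V s" and t: "qCauchy V t"
  shows "qadd (completion V) (cclass V s) (cclass V t) = cclass V (\<lambda>n. qadd V (s n) (t n))"
proof -
  have "cclass V (\<lambda>n. qadd V (s n) (t n))
      = cclass V (\<lambda>n. qadd V (crep (cclass V s) n) (crep (cclass V t) n))"
    using crep_cclass[OF s] crep_cclass[OF t] s t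
    by (subst cclass_eq_iff) (auto intro: qCauchy_add qasymp_add)
  then show ?thesis
    by (simp add: completion_def)
qed

lemma completion_smul:
  assumes s: "qCauchy V s"
  shows "qsmul (completion V) c (cclass V s) = cclass V (\<lambda>n. qsmul V c (s n))"
proof -
  have "cclass V (\<lambda>n. qsmul V c (s n)) = cclass V (\<lambda>n. qsmul V c (crep (cclass V s) n))"
    using crep_cclass[OF s] s by (subst cclass_eq_iff) (auto intro: qCauchy_smul qasymp_smul)
  then show ?thesis
    by (simp add: completion_def)
qed

lemma completion_diff:
  assumes "qCauchy V s" "qCauchy V t"
  shows "qdiff (completion V) (cclass V s) (cclass V t) = cclass V (\<lambda>n. qdiff V (s n) (t n))"
  using assms by (simp add: qdiff_def completion_add completion_smul qCauchy_smul)

lemma completion_vspace: "vspace (completion V)"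
proof -
  note ops = completion_zero completion_add completion_smul completion_diff
    qCauchy_const qCauchy_add qCauchy_smul cclass_in qCauchy_in vspace_laws
  show ?thesis
    unfolding vspace_def
  proof (intro conjI ballI allI)
    fix A assume "A \<in> qcar (completion V)"
    then obtain s where s: "qCauchy V s" "A = cclass V s"
      by (rule completion_cases)
    show "qadd (completion V) (qzero (completion V)) A = A"
      "qdiff (completion V) A A = qzero (completion V)" "qsmul (completion V) 1 A = A"
      and "qsmul (completion V) c A \<in> qcar (completion V)"
      "qsmul (completion V) (c + d) A
        = qadd (completion V) (qsmul (completion V) c A) (qsmul (completion V) d A)"
      "qsmul (completion V) (c * d) A = qsmul (completion V) c (qsmul (completion V) d A)" for c d
      using s(1) by (simp_all add: s(2) ops)
    fix B assume "B \<in> qcar (completion V)"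
    then obtain t where t: "qCauchy V t" "B = cclass V t"
      by (rule completion_cases)
    show "qadd (completion V) A B = qadd (completion V) B A"
      using s(1) t(1) by (simp add: s(2) t(2) ops vspace_comm[of V "s _"])
    show "qadd (completion V) A B \<in> qcar (completion V)"
      and "qsmul (completion V) c (qadd (completion V) A B)
        = qadd (completion V) (qsmul (completion V) c A) (qsmul (completion V) c B)" for c
      using s(1) t(1) by (simp_all add: s(2) t(2) ops)
    fix C assume "C \<in> qcar (completion V)"
    then obtain u where u: "qCauchy V u" "C = cclass V u"
      by (rule completion_cases)
    show "qadd (completion V) (qadd (completion V) A B) C
        = qadd (completion V) A (qadd (completion V) B C)"
      using s(1) t(1) u(1) by (simp_all add: s(2) t(2) u(2) ops)
  qed (simp add: ops)
qed

lemma cclass_bounded_member: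
  assumes s: "qCauchy V s" and r: "\<forall>\<^sub>F n in sequentially. qnorm V (s n) \<le> r"
  obtains t where "t \<in> cclass V s" "\<And>n. qnorm V (t n) \<le> r"
proof -
  obtain N where "\<And>n. n \<ge> N \<Longrightarrow> qnorm V (s n) \<le> r"
    using r by (auto simp: eventually_sequentially)
  then show ?thesis
    using qCauchy_shift[OF V s, of N] that[of "\<lambda>n. s (n + N)"] s by (simp add: mem_cclass_iff)
qed

lemma completion_qnorm_bound_nonneg:
  assumes "A \<in> qcar (completion V)" "s \<in> A" "\<And>n. qnorm V (s n) \<le> r"
  shows "0 \<le> r"
  using qnorm_nonneg[OF V qCauchy_in[OF completion_mem(1)[OF assms(1,2)]]] assms(3) order_trans by blast

lemma completion_qnorm_bounds_nonempty:
  assumes "A \<in> qcar (completion V)"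
  shows "{r. \<exists>s\<in>A. \<forall>n. qnorm V (s n) \<le> r} \<noteq> {}"
proof -
  obtain s where s: "qCauchy V s" "A = cclass V s"
    using assms by (rule completion_cases)
  obtain r where "\<forall>\<^sub>F n in sequentially. qnorm V (s n) \<le> r"
    using qCauchy_bounded[OF V s(1)] .
  then obtain t where "t \<in> A" "\<And>n. qnorm V (t n) \<le> r"
    using cclass_bounded_member[OF s(1)] s(2) by blast
  then show ?thesis
    by blast
qed

lemma completion_qnorm_nonneg:
  assumes A: "A \<in> qcar (completion V)"
  shows "0 \<le> qnorm (completion V) A"
  using cInf_greatest[OF completion_qnorm_bounds_nonempty[OF A], of 0] completion_qnorm_bound_nonneg[OF A]
  by (auto simp: completion_def)

lemma completion_qnorm_le:
  assumes s: "qCauchy V s" and r: "\<forall>\<^sub>F n in sequentially. qnorm V (s n) \<le> r"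
  shows "qnorm (completion V) (cclass V s) \<le> r"
proof -
  obtain t where "t \<in> cclass V s" "\<And>n. qnorm V (t n) \<le> r"
    using cclass_bounded_member[OF s r] by blast
  moreover have "bdd_below {r. \<exists>t\<in>cclass V s. \<forall>n. qnorm V (t n) \<le> r}"
    using completion_qnorm_bound_nonneg[OF cclass_in[OF s]] by (intro bdd_belowI[of _ 0]) blast
  ultimately show ?thesis
    by (auto simp: completion_def intro!: cInf_lower)
qed

lemma completion_qnorm_lessE:
  assumes A: "A \<in> qcar (completion V)" and r: "qnorm (completion V) A < r"
  obtains s where "qCauchy V s" "A = cclass V s" "\<And>n. qnorm V (s n) \<le> r"
proof -
  have "Inf {r. \<exists>s\<in>A. \<forall>n. qnorm V (s n) \<le> r} < r"
    using r by (simp add: completion_def)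
  from cInf_lessD[OF completion_qnorm_bounds_nonempty[OF A] this]
  obtain q s where "q < r" "s \<in> A" "\<And>n. qnorm V (s n) \<le> q"
    by blast
  then show ?thesis
    using that[of s] completion_mem[OF A] by (metis less_imp_le order_trans)
qed

lemma completion_qnorm_less_eventually:
  assumes s: "qCauchy V s" and r: "qnorm (completion V) (cclass V s) < r"
  shows "\<forall>\<^sub>F n in sequentially. qnorm V (s n) \<le> 2 * qmodulus V * r"
proof -
  obtain t where t: "qCauchy V t" "cclass V s = cclass V t" "\<And>n. qnorm V (t n) \<le> r"
    using completion_qnorm_lessE[OF cclass_in[OF s] r] by metis
  have "(\<lambda>n. qnorm V (qdiff V (s n) (t n))) \<longlonglongrightarrow> 0"
    using t s by (simp add: cclass_eq_iff qasymp_tendsto)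
  moreover have "0 < r"
    using completion_qnorm_nonneg[OF cclass_in[OF s]] r by simp
  ultimately have "\<forall>\<^sub>F n in sequentially. qnorm V (qdiff V (s n) (t n)) < r"
    by (rule order_tendstoD(2))
  then show ?thesis
  proof eventually_elim
    case (elim n)
    then have "qnorm V (s n) \<le> qmodulus V * (r + r)"
      by (intro qnorm_le_diff[OF V qCauchy_in[OF s] qCauchy_in[OF t(1)] _ t(3)] less_imp_le)
    then show ?case
      by simp
  qed
qed

lemma completion_qnorm_definite:
  assumes A: "A \<in> qcar (completion V)" and zero: "qnorm (completion V) A = 0"
  shows "A = qzero (completion V)"
proof -
  obtain s where s: "qCauchy V s" "A = cclass V s"
    using A by (rule completion_cases)
  note s_in [simp] = qCauchy_in[OF s(1)]
  have "\<forall>\<^sub>F n in sequentially. norm (qnorm V (s n)) < e" if "0 < e" for e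
  proof -
    have "\<forall>\<^sub>F n in sequentially. qnorm V (s n) \<le> 2 * qmodulus V * (e / (4 * qmodulus V))"
      using s zero that by (intro completion_qnorm_less_eventually) auto
    then show ?thesis
      by eventually_elim (use that in auto)
  qed
  then have "(\<lambda>n. qnorm V (s n)) \<longlonglongrightarrow> 0"
    by (simp add: tendsto_iff)
  then have "qasymp V sequentially s (\<lambda>_. qzero V)"
    by (simp add: qasymp_def)
  then show ?thesis
    using s by (simp add: completion_zero cclass_eq_iff qCauchy_const)
qed

lemma completion_qnorm_smul_le:
  assumes A: "A \<in> qcar (completion V)"
  shows "qnorm (completion V) (qsmul (completion V) c A) \<le> norm c * qnorm (completion V) A"
proof -
  have "qnorm (completion V) (qsmul (completion V) c A) \<le> norm c * r" if "qnorm (completion V) A < r" for r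
  proof -
    obtain s where s: "qCauchy V s" "A = cclass V s" "\<And>n. qnorm V (s n) \<le> r"
      using completion_qnorm_lessE[OF A \<open>qnorm (completion V) A < r\<close>] by blast
    have "qnorm V (qsmul V c (s n)) \<le> norm c * r" for n
      by (simp add: qnorm_smul qCauchy_in[OF s(1)] mult_left_mono s(3))
    then show ?thesis
      using s by (simp add: completion_smul completion_qnorm_le qCauchy_smul)
  qed
  then show ?thesis
    using le_affine_if_le_above[of "qnorm (completion V) A" _ "norm c" 0] by simp
qed

lemma completion_qnorm_add_le:
  assumes A: "A \<in> qcar (completion V)" and B: "B \<in> qcar (completion V)"
  shows "qnorm (completion V) (qadd (completion V) A B)
    \<le> qmodulus V * (qnorm (completion V) A + qnorm (completion V) B)"
proof -
  let ?AB = "qnorm (completion V) (qadd (completion V) A B)"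
  have "?AB \<le> qmodulus V * a + qmodulus V * b"
    if a: "qnorm (completion V) A < a" and b: "qnorm (completion V) B < b" for a b
  proof -
    obtain s where s: "qCauchy V s" "A = cclass V s" "\<And>n. qnorm V (s n) \<le> a"
      using completion_qnorm_lessE[OF A a] by blast
    obtain t where t: "qCauchy V t" "B = cclass V t" "\<And>n. qnorm V (t n) \<le> b"
      using completion_qnorm_lessE[OF B b] by blast
    have "qnorm V (qadd V (s n) (t n)) \<le> qmodulus V * (a + b)" for n
      by (intro qnorm_add_le_bounds V qCauchy_in[OF s(1)] qCauchy_in[OF t(1)] s(3) t(3))
    then show ?thesis
      using s t by (simp add: completion_add completion_qnorm_le qCauchy_add distrib_left)
  qed
  then have "?AB \<le> qmodulus V * b + qmodulus V * qnorm (completion V) A"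
    if "qnorm (completion V) B < b" for b
    using le_affine_if_le_above[of "qnorm (completion V) A" ?AB "qmodulus V" "qmodulus V * b"] that
    by (simp add: add.commute)
  then show ?thesis
    using le_affine_if_le_above[of "qnorm (completion V) B" ?AB "qmodulus V"]
    by (simp add: distrib_left add.commute)
qed

lemma completion_quasinormed [simp]: "quasinormed (completion V)"
  by (intro quasinormedI[where C = "qmodulus V"] completion_vspace completion_qnorm_nonneg
      completion_qnorm_definite completion_qnorm_smul_le completion_qnorm_add_le)

lemma cemb_qoperator: "qoperator V (completion V) (cemb V)"
  unfolding cemb_def
  by (rule qoperatorI[where C = 1])
    (auto simp: cclass_in qCauchy_const completion_add completion_smul intro!: completion_qnorm_le)

lemma cemb_in [simp]: "v \<in> qcar V \<Longrightarrow> cemb V v \<in> qcar (completion V)"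
  by (rule qoperator_in[OF cemb_qoperator])

lemma cemb_bounded_below:
  assumes v: "v \<in> qcar V"
  shows "qnorm V v \<le> 2 * qmodulus V * qnorm (completion V) (cemb V v)"
proof -
  have "qnorm V v \<le> 2 * qmodulus V * r" if "qnorm (completion V) (cemb V v) < r" for r
    using completion_qnorm_less_eventually[OF qCauchy_const[OF V v]] that by (simp add: cemb_def)
  then show ?thesis
    using le_affine_if_le_above[of "qnorm (completion V) (cemb V v)" _ "2 * qmodulus V" 0] by simp
qed

lemma cemb_qasymp_cclass:
  assumes s: "qCauchy V s"
  shows "qasymp (completion V) sequentially (\<lambda>n. cemb V (s n)) (\<lambda>_. cclass V s)"
proof -
  let ?C = "completion V"
  note s_in [simp] = qCauchy_in[OF s]
  have tail: "qdiff ?C (cemb V (s n)) (cclass V s) = cclass V (\<lambda>i. qdiff V (s n) (s i))"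
    "qCauchy V (\<lambda>i. qdiff V (s n) (s i))" for n
    using s by (simp_all add: cemb_def completion_diff qCauchy_const qCauchy_diff)
  have "\<forall>\<^sub>F n in sequentially. norm (qnorm ?C (qdiff ?C (cemb V (s n)) (cclass V s))) < e" if "0 < e" for e
  proof -
    obtain N where N: "\<And>m n. m \<ge> N \<Longrightarrow> n \<ge> N \<Longrightarrow> qnorm V (qdiff V (s m) (s n)) < e / 2"
      using s \<open>0 < e\<close> unfolding qCauchy_def by (meson half_gt_zero)
    have "qnorm ?C (cclass V (\<lambda>i. qdiff V (s n) (s i))) \<le> e / 2" if "n \<ge> N" for n
      using N[OF that]
      by (intro completion_qnorm_le tail) (auto simp: eventually_sequentially intro: less_imp_le)
    then show ?thesis
      using \<open>0 < e\<close> by (force simp: tail cclass_in eventually_sequentially)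
  qed
  then show ?thesis
    using s by (simp add: qasymp_def tendsto_iff cclass_in)
qed

lemma completion_quasi_banach: "quasi_banach (completion V)"
proof -
  let ?C = "completion V"
  have "\<exists>x. qasymp ?C sequentially A (\<lambda>_. x)" if A: "qCauchy ?C A" for A
  proof -
    note A_in [simp] = qCauchy_in[OF A]
    have "\<exists>v\<in>qcar V. qnorm ?C (qdiff ?C (A k) (cemb V v)) < inverse (real (Suc k))" for k
    proof -
      obtain s where s: "qCauchy V s" "A k = cclass V s"
        using completion_cases[OF A_in] .
      have "\<forall>\<^sub>F n in sequentially. qnorm ?C (qdiff ?C (A k) (cemb V (s n))) < inverse (real (Suc k))"
        using qasymp_tendsto[OF qasymp_sym[OF _ cemb_qasymp_cclass[OF s(1)]]] unfolding s(2)
        by (intro order_tendstoD(2)) auto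
      then show ?thesis
        using qCauchy_in[OF s(1)] by (meson eventually_sequentially order_refl)
    qed
    then obtain t where t [simp]: "\<And>k. t k \<in> qcar V"
      and At: "\<And>k. qnorm ?C (qdiff ?C (A k) (cemb V (t k))) < inverse (real (Suc k))"
      by metis
    have asymp: "qasymp ?C sequentially A (\<lambda>k. cemb V (t k))"
      using At by (intro qasympI[OF _ _ _ _ LIMSEQ_inverse_real_of_nat]) (auto intro: less_imp_le)
    have "qCauchy V t"
      using qasymp_qCauchy[OF _ asymp A] cemb_bounded_below qoperator_qlinear[OF cemb_qoperator]
      by (intro bounded_below_qCauchy[of V ?C "cemb V"]) auto
    from qasymp_trans[OF _ asymp cemb_qasymp_cclass[OF this]] show ?thesis
      by auto
  qed
  then show ?thesis
    by (simp add: quasi_banach_iff)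
qed

lemma completion_operator_eqI:
  assumes W: "quasinormed W" and f: "qoperator (completion V) W f" and g: "qoperator (completion V) W g"
    and eq: "\<And>v. v \<in> qcar V \<Longrightarrow> f (cemb V v) = g (cemb V v)" and A: "A \<in> qcar (completion V)"
  shows "f A = g A"
proof -
  obtain s where s: "qCauchy V s" "A = cclass V s"
    using A by (rule completion_cases)
  have limit: "qasymp W sequentially (\<lambda>n. h (cemb V (s n))) (\<lambda>_. h A)"
    if "qoperator (completion V) W h" for h
    using qoperator_qasymp[OF that _ W cemb_qasymp_cclass[OF s(1)]] s(2) by simp
  show ?thesis
    using qasymp_limit_unique[OF W limit[OF f], of "g A"] limit[OF g] by (simp add: eq qCauchy_in[OF s(1)])
qed

end

definition clift :: "('k::real_normed_field, 'b) qspace \<Rightarrow> ('a \<Rightarrow> 'b) \<Rightarrow> (nat \<Rightarrow> 'a) set \<Rightarrow> 'b" where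
  "clift W f A = (THE x. x \<in> qcar W \<and> (\<forall>s\<in>A. qlim W (\<lambda>n. f (s n)) x))"

context
  fixes V :: "('k::real_normed_field, 'a) qspace" and W :: "('k, 'b) qspace" and f
  assumes V [simp]: "quasinormed V" and W [simp]: "quasi_banach W" and f: "qoperator V W f"
begin

lemma clift_eqI:
  assumes s: "qCauchy V s" and x: "qasymp W sequentially (\<lambda>n. f (s n)) (\<lambda>_. x)"
  shows "clift W f (cclass V s) = x"
proof -
  have limit: "qasymp W sequentially (\<lambda>n. f (t n)) (\<lambda>_. x)" if "t \<in> cclass V s" for t
    using that qasymp_trans[OF _ qoperator_qasymp[OF f V _ qasymp_sym[OF V]] x]
    by (simp add: mem_cclass_iff s)
  show ?thesis
    unfolding clift_def
  proof (rule the_equality)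
    show "x \<in> qcar W \<and> (\<forall>t\<in>cclass V s. qlim W (\<lambda>n. f (t n)) x)"
      using limit qasymp_in_right[OF x] by (auto simp: qasymp_def qlim_def)
    fix y assume "y \<in> qcar W \<and> (\<forall>t\<in>cclass V s. qlim W (\<lambda>n. f (t n)) y)"
    then have "qasymp W sequentially (\<lambda>n. f (s n)) (\<lambda>_. y)"
      using cclass_self[OF V s] qasymp_in_left[OF x] by (auto simp: qasymp_def qlim_def)
    then show "y = x"
      using qasymp_limit_unique[OF _ x] by (simp add: eq_commute)
  qed
qed

lemma clift_qasymp:
  assumes s: "qCauchy V s"
  shows "qasymp W sequentially (\<lambda>n. f (s n)) (\<lambda>_. clift W f (cclass V s))"
  using quasi_banach_complete[OF W qoperator_qCauchy[OF f V _ s]] clift_eqI[OF s] by fastforce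

lemma clift_cemb: "v \<in> qcar V \<Longrightarrow> clift W f (cemb V v) = f v"
  unfolding cemb_def by (intro clift_eqI qCauchy_const qasymp_refl) (simp_all add: qoperator_in[OF f])

lemma clift_qoperator: "qoperator (completion V) W (clift W f)"
proof -
  obtain K where K: "0 \<le> K" "\<And>x. x \<in> qcar V \<Longrightarrow> qnorm W (f x) \<le> K * qnorm V x"
    using qoperator_bound[OF f V] by blast
  show ?thesis
  proof (rule qoperatorI)
    fix A assume A: "A \<in> qcar (completion V)"
    then obtain s where s: "qCauchy V s" "A = cclass V s"
      by (rule completion_cases[OF V])
    note s_in = qCauchy_in[OF s(1)]
    show "clift W f A \<in> qcar W"
      using qasymp_in_right[OF clift_qasymp[OF s(1)]] s(2) by simp
    show "clift W f (qsmul (completion V) c A) = qsmul W c (clift W f A)" for c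
      using qasymp_smul[OF _ clift_qasymp[OF s(1)]] s
      by (simp add: completion_smul clift_eqI qCauchy_smul qoperator_smul[OF f s_in])
    have "qnorm W (clift W f A) \<le> qmodulus W * K * r" if r: "qnorm (completion V) A < r" for r
    proof -
      obtain t where t: "qCauchy V t" "A = cclass V t" "\<And>n. qnorm V (t n) \<le> r"
        using completion_qnorm_lessE[OF V A r] by blast
      have "qnorm W (f (t n)) \<le> K * r" for n
        by (rule order_trans[OF K(2)[OF qCauchy_in[OF t(1)]] mult_left_mono[OF t(3) K(1)]])
      then show ?thesis
        using qasymp_limit_qnorm_le[OF _ clift_qasymp[OF t(1)]] t(2) by (simp add: mult.assoc)
    qed
    then show "qnorm W (clift W f A) \<le> qmodulus W * K * qnorm (completion V) A"
      using le_affine_if_le_above[of "qnorm (completion V) A" _ "qmodulus W * K" 0] by simp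
    fix B assume "B \<in> qcar (completion V)"
    then obtain t where t: "qCauchy V t" "B = cclass V t"
      by (rule completion_cases[OF V])
    show "clift W f (qadd (completion V) A B) = qadd W (clift W f A) (clift W f B)"
      using qasymp_add[OF _ clift_qasymp[OF s(1)] clift_qasymp[OF t(1)]] s t
      by (simp add: completion_add clift_eqI qCauchy_add qoperator_add[OF f s_in qCauchy_in[OF t(1)]])
  qed
qed

end

section \<open>Quasilinear maps and twisted sums\<close>

lemma twisted_simps [simp]:
  "qcar (twisted Y X X0 \<Phi>) = qcar Y \<times> X0"
  "qzero (twisted Y X X0 \<Phi>) = (qzero Y, qzero X)"
  "qadd (twisted Y X X0 \<Phi>) p q = (qadd Y (fst p) (fst q), qadd X (snd p) (snd q))"
  "qsmul (twisted Y X X0 \<Phi>) c p = (qsmul Y c (fst p), qsmul X c (snd p))"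
  "qdiff (twisted Y X X0 \<Phi>) p q = (qdiff Y (fst p) (fst q), qdiff X (snd p) (snd q))"
  "qnorm (twisted Y X X0 \<Phi>) p = qnorm Y (qdiff Y (fst p) (\<Phi> (snd p))) + qnorm X (snd p)"
  by (simp_all add: twisted_def qdiff_def split: prod.splits)

locale dense_subspace =
  fixes X :: "('k::real_normed_field, 'x) qspace" and X0 :: "'x set"
  assumes quasi_banach_X [simp]: "quasi_banach X"
    and subspace_sub: "X0 \<subseteq> qcar X"
    and subspace_zero [simp]: "qzero X \<in> X0"
    and subspace_add [simp]: "\<And>x y. x \<in> X0 \<Longrightarrow> y \<in> X0 \<Longrightarrow> qadd X x y \<in> X0"
    and subspace_smul [simp]: "\<And>c x. x \<in> X0 \<Longrightarrow> qsmul X c x \<in> X0"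
    and dense: "\<And>x. x \<in> qcar X \<Longrightarrow> \<exists>s. range s \<subseteq> X0 \<and> qasymp X sequentially s (\<lambda>_. x)"
begin

lemma subspace_in [simp]: "x \<in> X0 \<Longrightarrow> x \<in> qcar X"
  using subspace_sub by blast

lemma subspace_diff [simp]: "x \<in> X0 \<Longrightarrow> y \<in> X0 \<Longrightarrow> qdiff X x y \<in> X0"
  by (simp add: qdiff_def)

lemma geometric_approximation:
  assumes x [simp]: "x \<in> qcar X" and r: "0 < r" "r < 1"
  obtains t where "\<And>n. t n \<in> X0" "qasymp X sequentially t (\<lambda>_. x)"
    "\<And>n. qnorm X (qdiff X (t (Suc n)) (t n)) \<le> 2 * qmodulus X * r ^ n"
proof -
  have "\<exists>t\<in>X0. qnorm X (qdiff X t x) < r ^ n" for n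
  proof -
    obtain s where s: "range s \<subseteq> X0" "qasymp X sequentially s (\<lambda>_. x)"
      using dense[OF x] by blast
    have "\<forall>\<^sub>F k in sequentially. qnorm X (qdiff X (s k) x) < r ^ n"
      using qasymp_tendsto[OF s(2)] r(1) by (intro order_tendstoD(2)) auto
    then show ?thesis
      using s(1) by (auto simp: eventually_sequentially)
  qed
  then obtain t where t [simp]: "\<And>n. t n \<in> X0" and tx: "\<And>n. qnorm X (qdiff X (t n) x) < r ^ n"
    by metis
  have "(\<lambda>n. r ^ n) \<longlonglongrightarrow> 0"
    using r by (intro LIMSEQ_power_zero) auto
  then have limit: "qasymp X sequentially t (\<lambda>_. x)"
    using tx by (intro qasympI) (auto intro: less_imp_le)
  have "qnorm X (qdiff X (t (Suc n)) (t n)) \<le> 2 * qmodulus X * r ^ n" for n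
  proof -
    have "qnorm X (qdiff X (t (Suc n)) (t n))
        \<le> qmodulus X * (qnorm X (qdiff X (t (Suc n)) x) + qnorm X (qdiff X x (t n)))"
      by (simp add: qnorm_diff_triangle)
    also have "\<dots> \<le> qmodulus X * (r ^ Suc n + r ^ n)"
      using tx[of "Suc n"] tx[of n] qnorm_diff_commute[of X x "t n"]
      by (intro mult_left_mono add_mono) (auto intro: less_imp_le)
    also have "\<dots> \<le> qmodulus X * (r ^ n + r ^ n)"
      using r by (intro mult_left_mono add_right_mono) (auto simp: mult_left_le_one_le)
    finally show ?thesis
      by simp
  qed
  then show ?thesis
    using that[of t] limit by simp
qed

end

locale quasilinear = dense_subspace X X0
  for Y :: "('k::real_normed_field, 'y) qspace" and X :: "('k, 'x) qspace" and X0 :: "'x set"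
    and \<Phi> :: "'x \<Rightarrow> 'y" +
  assumes quasi_banach_Y [simp]: "quasi_banach Y"
    and map_in [simp]: "\<And>x. x \<in> X0 \<Longrightarrow> \<Phi> x \<in> qcar Y"
    and map_smul [simp]: "\<And>c x. x \<in> X0 \<Longrightarrow> \<Phi> (qsmul X c x) = qsmul Y c (\<Phi> x)"
    and map_quasiadditive: "\<exists>Q. \<forall>x\<in>X0. \<forall>y\<in>X0.
          qnorm Y (qdiff Y (\<Phi> (qadd X x y)) (qadd Y (\<Phi> x) (\<Phi> y))) \<le> Q * (qnorm X x + qnorm X y)"
begin

abbreviation "V \<equiv> twisted Y X X0 \<Phi>"
abbreviation "Z \<equiv> Zsp Y X X0 \<Phi>"
abbreviation "inc \<equiv> Zinc Y X X0 \<Phi>"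

lemma map_zero [simp]: "\<Phi> (qzero X) = qzero Y"
  using map_smul[OF subspace_zero, of 0] by simp

lemma twisted_vspace: "vspace V"
proof -
  have "vspace Y" "vspace X"
    by simp_all
  then show ?thesis
    unfolding vspace_def by (auto simp: vspace_laws intro: vspace_comm)
qed

lemma twisted_qnorm_add_le:
  "\<exists>K. \<forall>p\<in>qcar V. \<forall>q\<in>qcar V. qnorm V (qadd V p q) \<le> K * (qnorm V p + qnorm V q)"
proof -
  obtain Q where Q: "\<And>x y. x \<in> X0 \<Longrightarrow> y \<in> X0 \<Longrightarrow>
      qnorm Y (qdiff Y (\<Phi> (qadd X x y)) (qadd Y (\<Phi> x) (\<Phi> y))) \<le> Q * (qnorm X x + qnorm X y)"
    using map_quasiadditive by blast
  let ?C = "qmodulus Y" and ?D = "qmodulus X"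
  have "qnorm V (qadd V (y, x) (y', x'))
      \<le> (?C * ?C + ?C * \<bar>Q\<bar> + ?D) * (qnorm V (y, x) + qnorm V (y', x'))"
    if [simp]: "y \<in> qcar Y" "x \<in> X0" "y' \<in> qcar Y" "x' \<in> X0" for y x y' x'
  proof -
    let ?a = "qnorm Y (qdiff Y y (\<Phi> x)) + qnorm Y (qdiff Y y' (\<Phi> x'))" and ?b = "qnorm X x + qnorm X x'"
    have pairs: "qnorm Y (qdiff Y (qadd Y y y') (qadd Y (\<Phi> x) (\<Phi> x'))) \<le> ?C * ?a"
      by (simp add: vspace_add_diff_add qnorm_add_le)
    have "qnorm Y (qdiff Y (qadd Y (\<Phi> x) (\<Phi> x')) (\<Phi> (qadd X x x'))) \<le> Q * ?b"
      using Q[of x x'] by (simp add: qnorm_diff_commute[of Y "qadd Y _ _"])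
    also have "\<dots> \<le> \<bar>Q\<bar> * ?b"
      by (intro mult_right_mono) auto
    finally have defect: "qnorm Y (qdiff Y (qadd Y (\<Phi> x) (\<Phi> x')) (\<Phi> (qadd X x x'))) \<le> \<bar>Q\<bar> * ?b" .
    have "qnorm Y (qdiff Y (qadd Y y y') (\<Phi> (qadd X x x')))
        \<le> ?C * (qnorm Y (qdiff Y (qadd Y y y') (qadd Y (\<Phi> x) (\<Phi> x')))
              + qnorm Y (qdiff Y (qadd Y (\<Phi> x) (\<Phi> x')) (\<Phi> (qadd X x x'))))"
      by (simp add: qnorm_diff_triangle)
    also have "\<dots> \<le> ?C * (?C * ?a + \<bar>Q\<bar> * ?b)"
      by (intro mult_left_mono add_mono pairs defect) simp
    finally have "qnorm V (qadd V (y, x) (y', x')) \<le> ?C * (?C * ?a + \<bar>Q\<bar> * ?b) + ?D * ?b"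
      by (simp add: add_mono qnorm_add_le)
    also have "\<dots> = (?C * ?C) * ?a + (?C * \<bar>Q\<bar> + ?D) * ?b"
      by (simp add: algebra_simps)
    also have "\<dots> \<le> (?C * ?C + ?C * \<bar>Q\<bar> + ?D) * ?a + (?C * ?C + ?C * \<bar>Q\<bar> + ?D) * ?b"
      by (intro add_mono mult_right_mono) auto
    finally show ?thesis
      by (simp add: algebra_simps)
  qed
  then show ?thesis
    by (intro exI[of _ "?C * ?C + ?C * \<bar>Q\<bar> + ?D"]) (auto simp del: twisted_simps(3,6))
qed

lemma twisted_quasinormed [simp]: "quasinormed V"
proof -
  obtain K where "\<And>p q. p \<in> qcar V \<Longrightarrow> q \<in> qcar V \<Longrightarrow> qnorm V (qadd V p q) \<le> K * (qnorm V p + qnorm V q)"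
    using twisted_qnorm_add_le by blast
  then show ?thesis
  proof (rule quasinormedI[OF twisted_vspace, rotated -1])
    fix p assume p: "p \<in> qcar V"
    then show "0 \<le> qnorm V p" "qnorm V (qsmul V c p) \<le> norm c * qnorm V p" for c
      by (auto simp: qnorm_smul distrib_left simp flip: vspace_smul_diff)
    assume zero: "qnorm V p = 0"
    obtain y x where "p = (y, x)" "y \<in> qcar Y" "x \<in> X0"
      using p by auto
    then show "p = qzero V"
      using zero by (auto simp: add_nonneg_eq_0_iff qnorm_diff_eq_0 qnorm_eq_0)
  qed
qed

lemma Zsp_quasi_banach [simp]: "quasi_banach Z"
  unfolding Zsp_def by (rule completion_quasi_banach[OF twisted_quasinormed])

lemma pair_qoperator: "qoperator Y V (\<lambda>y. (y, qzero X))"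
  by (rule qoperatorI[where C = 1]) auto

lemma snd_qoperator: "qoperator V X snd"
  by (rule qoperatorI[where C = 1]) auto

lemma Zinc_eq_cemb: "inc y = cemb V (y, qzero X)"
  by (simp add: Zinc_def cemb_def)

lemma Zproj_eq_clift: "Zproj X = clift X snd"
  by (simp add: fun_eq_iff Zproj_def clift_def)

lemma Zinc_qoperator: "qoperator Y Z inc"
  using qoperator_comp[OF pair_qoperator cemb_qoperator[OF twisted_quasinormed]]
  by (simp add: Zinc_eq_cemb[abs_def] Zsp_def)

lemma Zproj_qoperator: "qoperator Z X (Zproj X)"
  unfolding Zproj_eq_clift Zsp_def by (intro clift_qoperator snd_qoperator) simp_all

lemma Zproj_cemb: "p \<in> qcar V \<Longrightarrow> Zproj X (cemb V p) = snd p"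
  unfolding Zproj_eq_clift by (intro clift_cemb[OF _ _ snd_qoperator]) simp_all

lemma Zproj_inc: "y \<in> qcar Y \<Longrightarrow> Zproj X (inc y) = qzero X"
  by (simp add: Zinc_eq_cemb Zproj_cemb)

lemma Zinc_kernel: "qker Y Z inc = {qzero Y}"
proof -
  have "y = qzero Y" if "y \<in> qcar Y" "inc y = qzero Z" for y
  proof -
    have "qnorm V (y, qzero X) \<le> 2 * qmodulus V * qnorm Z (inc y)"
      using cemb_bounded_below[OF twisted_quasinormed, of "(y, qzero X)"] that(1)
      by (simp add: Zinc_eq_cemb Zsp_def)
    then have "qnorm Y y = 0"
      using that by (intro order_antisym) simp_all
    then show ?thesis
      using that(1) by (simp add: qnorm_eq_0)
  qed
  then show ?thesis
    using qoperator_zero[OF Zinc_qoperator] by (auto simp: qker_def)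
qed

lemma Zproj_kernel: "qker Z X (Zproj X) = inc ` qcar Y"
proof
  show "inc ` qcar Y \<subseteq> qker Z X (Zproj X)"
    using qoperator_in[OF Zinc_qoperator] by (auto simp: qker_def Zproj_inc)
  show "qker Z X (Zproj X) \<subseteq> inc ` qcar Y"
  proof
    fix A assume "A \<in> qker Z X (Zproj X)"
    then have A: "A \<in> qcar (completion V)" "clift X snd A = qzero X"
      by (auto simp: qker_def Zproj_eq_clift Zsp_def)
    obtain s where s: "qCauchy V s" "A = cclass V s"
      using completion_cases[OF twisted_quasinormed A(1)] .
    define t where "t n = qdiff Y (fst (s n)) (\<Phi> (snd (s n)))" for n
    have [simp]: "fst (s n) \<in> qcar Y" "snd (s n) \<in> X0" "t n \<in> qcar Y" for n
      using qCauchy_in[OF s(1), of n] by (auto simp: t_def)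
    have "qasymp X sequentially (\<lambda>n. snd (s n)) (\<lambda>_. qzero X)"
      using clift_qasymp[OF twisted_quasinormed quasi_banach_X snd_qoperator s(1)] A(2) s(2) by simp
    then have vertical: "qasymp V sequentially s (\<lambda>n. (t n, qzero X))"
      by (simp add: qasymp_def mem_Times_iff) (simp add: t_def vspace_diff_diff_self)
    have "qCauchy V (\<lambda>n. (t n, qzero X))"
      by (rule qasymp_qCauchy[OF twisted_quasinormed vertical s(1)])
    then have "qCauchy Y t"
      by (intro bounded_below_qCauchy[OF qoperator_qlinear[OF pair_qoperator], where C = 1]) auto
    then obtain l where l: "qasymp Y sequentially t (\<lambda>_. l)"
      using quasi_banach_complete[OF quasi_banach_Y] by blast
    note l_in = qasymp_in_right[OF l]
    have "qasymp V sequentially s (\<lambda>_. (l, qzero X))"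
      using qoperator_qasymp[OF pair_qoperator _ _ l]
      by (intro qasymp_trans[OF twisted_quasinormed vertical]) simp
    then have "A = inc l"
      using s l_in by (simp add: Zinc_def cclass_eq_iff qCauchy_const)
    then show "A \<in> inc ` qcar Y"
      using l_in by blast
  qed
qed

text \<open>The lift sums \<open>\<Phi>\<close> over the increments of the given sequence.\<close>

lemma rapid_sequence_lift:
  assumes t [simp]: "\<And>n. t n \<in> X0"
    and rapid: "\<And>n. qnorm X (qdiff X (t (Suc n)) (t n)) \<le> M * (1 / (2 * qmodulus V)) ^ n"
  obtains w where "qCauchy V w" "\<And>n. snd (w n) = t n"
proof -
  define y where "y = rec_nat (qzero Y) (\<lambda>n z. qadd Y z (\<Phi> (qdiff X (t (Suc n)) (t n))))"
  have y_0: "y 0 = qzero Y" and y_Suc: "y (Suc n) = qadd Y (y n) (\<Phi> (qdiff X (t (Suc n)) (t n)))" for n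
    by (simp_all add: y_def)
  have y [simp]: "y n \<in> qcar Y" for n
    by (induction n) (simp_all add: y_0 y_Suc)
  have "qnorm V (qdiff V (y (Suc n), t (Suc n)) (y n, t n)) = qnorm X (qdiff X (t (Suc n)) (t n))" for n
    by (simp add: y_Suc vspace_add_diff_self)
  then have "qCauchy V (\<lambda>n. (y n, t n))"
    using rapid
    by (intro qCauchy_geometric[OF twisted_quasinormed _ refl]) (simp_all del: twisted_simps(5,6))
  then show ?thesis
    using that by simp
qed

lemma Zproj_surj: "Zproj X ` qcar Z = qcar X"
proof
  show "Zproj X ` qcar Z \<subseteq> qcar X"
    using qoperator_in[OF Zproj_qoperator] by blast
  show "qcar X \<subseteq> Zproj X ` qcar Z"
  proof
    fix x assume "x \<in> qcar X"
    moreover have "0 < 1 / (2 * qmodulus V)" "1 / (2 * qmodulus V) < 1"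
      using qmodulus_ge_1[OF twisted_quasinormed] by auto
    ultimately obtain t where t: "\<And>n. t n \<in> X0" "qasymp X sequentially t (\<lambda>_. x)"
      and rapid: "\<And>n. qnorm X (qdiff X (t (Suc n)) (t n)) \<le> 2 * qmodulus X * (1 / (2 * qmodulus V)) ^ n"
      by (rule geometric_approximation) blast
    obtain w where w: "qCauchy V w" "\<And>n. snd (w n) = t n"
      using rapid_sequence_lift[OF t(1) rapid] by blast
    have "Zproj X (cclass V w) = x"
      unfolding Zproj_eq_clift
      using w t by (intro clift_eqI[OF twisted_quasinormed quasi_banach_X snd_qoperator]) simp_all
    then show "x \<in> Zproj X ` qcar Z"
      using cclass_in[OF twisted_quasinormed w(1)] by (auto simp: Zsp_def)
  qed
qed

lemma inj_on_crep_Zsp: "inj_on crep (qcar Z)"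
  unfolding Zsp_def by (rule inj_on_crep[OF twisted_quasinormed])

end

lemma qoperator_quasilinear:
  assumes X: "quasi_banach X" and Y: "quasi_banach Y" and L: "qoperator X Y L"
  shows "quasilinear Y X (qcar X) L"
proof
  show "\<exists>s. range s \<subseteq> qcar X \<and> qasymp X sequentially s (\<lambda>_. x)" if "x \<in> qcar X" for x
    using that X by (intro exI[of _ "\<lambda>_. x"]) (auto simp: qasymp_refl)
  show "\<exists>Q. \<forall>x\<in>qcar X. \<forall>y\<in>qcar X.
      qnorm Y (qdiff Y (L (qadd X x y)) (qadd Y (L x) (L y))) \<le> Q * (qnorm X x + qnorm X y)"
    using X Y by (intro exI[of _ 0]) (simp add: qoperator_add[OF L] qoperator_in[OF L])
qed (use X Y in \<open>auto simp: qoperator_in[OF L] qoperator_smul[OF L]\<close>)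

lemma quasilinear_isometric:
  assumes \<Phi>: "quasilinear Y X X0 \<Phi>" and S: "isometric_iso Y Y' S" and T: "isometric_iso X X' T"
    and Y': "quasi_banach Y'" and X': "quasi_banach X'"
  shows "quasilinear Y' X' (T ` X0) (\<lambda>x. S (\<Phi> (inv_into (qcar X) T x)))"
proof -
  interpret quasilinear Y X X0 \<Phi> by fact
  note S_op = isometric_iso_qoperator[OF S] and T_op = isometric_iso_qoperator[OF T]
  note pull_out = qoperator_add[OF T_op, symmetric] qoperator_smul[OF T_op, symmetric]
    qoperator_add[OF S_op, symmetric] qoperator_smul[OF S_op, symmetric] qoperator_diff[OF S_op, symmetric]
    isometric_iso_inv[OF T] isometric_iso_norm[OF S] isometric_iso_norm[OF T]
  show ?thesis
  proof
    show "qzero X' \<in> T ` X0"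
      using qoperator_zero[OF T_op] X' by (force intro: image_eqI[of _ _ "qzero X"])
    show "\<exists>s. range s \<subseteq> T ` X0 \<and> qasymp X' sequentially s (\<lambda>_. x')" if "x' \<in> qcar X'" for x'
    proof -
      obtain x where x: "x \<in> qcar X" "x' = T x"
        using \<open>x' \<in> qcar X'\<close> by (auto simp flip: isometric_iso_image[OF T])
      obtain s where s: "range s \<subseteq> X0" "qasymp X sequentially s (\<lambda>_. x)"
        using dense[OF x(1)] by blast
      then have "qasymp X' sequentially (\<lambda>n. T (s n)) (\<lambda>_. x')"
        using qoperator_qasymp[OF T_op] X' x(2) by simp
      then show ?thesis
        using s(1) by (intro exI[of _ "\<lambda>n. T (s n)"]) auto
    qed
    obtain Q where "\<And>x y. x \<in> X0 \<Longrightarrow> y \<in> X0 \<Longrightarrow>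
        qnorm Y (qdiff Y (\<Phi> (qadd X x y)) (qadd Y (\<Phi> x) (\<Phi> y))) \<le> Q * (qnorm X x + qnorm X y)"
      using map_quasiadditive by blast
    then show "\<exists>Q. \<forall>x\<in>T ` X0. \<forall>y\<in>T ` X0.
        qnorm Y' (qdiff Y' (S (\<Phi> (inv_into (qcar X) T (qadd X' x y))))
          (qadd Y' (S (\<Phi> (inv_into (qcar X) T x))) (S (\<Phi> (inv_into (qcar X) T y)))))
        \<le> Q * (qnorm X' x + qnorm X' y)"
      by (intro exI[of _ Q]) (auto simp: pull_out)
  qed (use Y' X' in \<open>auto simp: pull_out qoperator_in[OF S_op] qoperator_in[OF T_op]\<close>)
qed

definition Zsection ::
  "('k::real_normed_field, 'y) qspace \<Rightarrow> ('k, 'x) qspace \<Rightarrow> ('x \<Rightarrow> 'y) \<Rightarrow> 'x \<Rightarrow> (nat \<Rightarrow> 'y \<times> 'x) set"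
where
  "Zsection Y X L x = cemb (twisted Y X (qcar X) L) (L x, x)"

lemma
  assumes X: "quasi_banach X" and Y: "quasi_banach Y" and L: "qoperator X Y L"
  shows Zsection_qoperator: "qoperator X (Zsp Y X (qcar X) L) (Zsection Y X L)"
    and Zproj_Zsection: "x \<in> qcar X \<Longrightarrow> Zproj X (Zsection Y X L x) = x"
proof -
  interpret quasilinear Y X "qcar X" L
    by (rule qoperator_quasilinear[OF assms])
  have "qoperator X V (\<lambda>x. (L x, x))"
    by (rule qoperatorI[where C = 1]) (auto simp: qoperator_add[OF L])
  from qoperator_comp[OF this cemb_qoperator[OF twisted_quasinormed]]
  show "qoperator X Z (Zsection Y X L)"
    by (simp add: Zsection_def[abs_def] Zsp_def)
  show "x \<in> qcar X \<Longrightarrow> Zproj X (Zsection Y X L x) = x"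
    by (simp add: Zsection_def Zproj_cemb)
qed

locale quasilinear_morphism =
  dom: quasilinear Y X X0 \<Phi> + cod: quasilinear Y' X' X0' \<Phi>'
  for Y :: "('k::real_normed_field, 'y) qspace" and X :: "('k, 'x) qspace" and X0 \<Phi>
    and Y' :: "('k, 'z) qspace" and X' :: "('k, 'w) qspace" and X0' \<Phi>' +
  fixes \<alpha> :: "'y \<Rightarrow> 'z" and \<beta> :: "'x \<Rightarrow> 'w"
  assumes qoperator_\<alpha>: "qoperator Y Y' \<alpha>" and qoperator_\<beta>: "qoperator X X' \<beta>"
    and subspace_\<beta>: "\<And>x. x \<in> X0 \<Longrightarrow> \<beta> x \<in> X0'"
    and intertwines: "\<And>x. x \<in> X0 \<Longrightarrow> \<alpha> (\<Phi> x) = \<Phi>' (\<beta> x)"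
begin

definition Zmap :: "(nat \<Rightarrow> 'y \<times> 'x) set \<Rightarrow> (nat \<Rightarrow> 'z \<times> 'w) set" where
  "Zmap = clift cod.Z (\<lambda>p. cemb cod.V (map_prod \<alpha> \<beta> p))"

lemma map_prod_qoperator: "qoperator dom.V cod.V (map_prod \<alpha> \<beta>)"
proof -
  obtain K where K: "0 \<le> K" "\<And>y. y \<in> qcar Y \<Longrightarrow> qnorm Y' (\<alpha> y) \<le> K * qnorm Y y"
    using qoperator_bound[OF qoperator_\<alpha>] by auto
  obtain M where M: "0 \<le> M" "\<And>x. x \<in> qcar X \<Longrightarrow> qnorm X' (\<beta> x) \<le> M * qnorm X x"
    using qoperator_bound[OF qoperator_\<beta>] by auto
  show ?thesis
  proof (rule qoperatorI)
    fix p assume "p \<in> qcar dom.V"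
    then have [simp]: "fst p \<in> qcar Y" "snd p \<in> X0"
      by auto
    show "map_prod \<alpha> \<beta> p \<in> qcar cod.V"
      by (auto simp: mem_Times_iff subspace_\<beta> qoperator_in[OF qoperator_\<alpha>])
    have "qnorm cod.V (map_prod \<alpha> \<beta> p)
        = qnorm Y' (\<alpha> (qdiff Y (fst p) (\<Phi> (snd p)))) + qnorm X' (\<beta> (snd p))"
      by (simp add: qoperator_diff[OF qoperator_\<alpha>] intertwines)
    also have "\<dots> \<le> K * qnorm Y (qdiff Y (fst p) (\<Phi> (snd p))) + M * qnorm X (snd p)"
      by (intro add_mono K M) simp_all
    also have "\<dots> \<le> (K + M) * qnorm dom.V p"
      using K(1) M(1) by (simp add: algebra_simps)
    finally show "qnorm cod.V (map_prod \<alpha> \<beta> p) \<le> (K + M) * qnorm dom.V p" .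
  qed (auto simp: qoperator_add[OF qoperator_\<alpha>] qoperator_add[OF qoperator_\<beta>]
      qoperator_smul[OF qoperator_\<alpha>] qoperator_smul[OF qoperator_\<beta>])
qed

lemma cemb_map_prod_qoperator: "qoperator dom.V cod.Z (\<lambda>p. cemb cod.V (map_prod \<alpha> \<beta> p))"
  unfolding Zsp_def by (intro qoperator_comp[OF map_prod_qoperator cemb_qoperator]) simp_all

lemma Zmap_qoperator: "qoperator dom.Z cod.Z Zmap"
  unfolding Zmap_def Zsp_def[of Y]
  by (intro clift_qoperator[OF _ _ cemb_map_prod_qoperator]) simp_all

lemma Zmap_cemb: "p \<in> qcar dom.V \<Longrightarrow> Zmap (cemb dom.V p) = cemb cod.V (map_prod \<alpha> \<beta> p)"
  unfolding Zmap_def by (intro clift_cemb[OF _ _ cemb_map_prod_qoperator]) simp_all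

lemma Zmap_inc: "y \<in> qcar Y \<Longrightarrow> Zmap (dom.inc y) = cod.inc (\<alpha> y)"
  using qoperator_zero[OF qoperator_\<beta>] by (simp add: dom.Zinc_eq_cemb cod.Zinc_eq_cemb Zmap_cemb)

lemma Zproj_Zmap: "a \<in> qcar dom.Z \<Longrightarrow> Zproj X' (Zmap a) = \<beta> (Zproj X a)"
  unfolding Zsp_def
proof (rule completion_operator_eqI[where f = "\<lambda>a. Zproj X' (Zmap a)" and g = "\<lambda>a. \<beta> (Zproj X a)"])
  show "qoperator (completion dom.V) X' (\<lambda>a. Zproj X' (Zmap a))"
    using qoperator_comp[OF Zmap_qoperator cod.Zproj_qoperator] by (simp add: Zsp_def)
  show "qoperator (completion dom.V) X' (\<lambda>a. \<beta> (Zproj X a))"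
    using qoperator_comp[OF dom.Zproj_qoperator qoperator_\<beta>] by (simp add: Zsp_def)
  show "Zproj X' (Zmap (cemb dom.V p)) = \<beta> (Zproj X (cemb dom.V p))" if "p \<in> qcar dom.V" for p
    using that qoperator_in[OF map_prod_qoperator that]
    by (simp add: Zmap_cemb cod.Zproj_cemb dom.Zproj_cemb)
qed simp_all

end

section \<open>Four-term exact sequences\<close>

lemma exact4D:
  assumes "exact4 Y X S"
  shows exact4_quasi_banach: "quasi_banach Y" "quasi_banach (E1 S)" "quasi_banach (E2 S)" "quasi_banach X"
    and exact4_arr_in: "qoperator Y (E1 S) (arr_in S)"
    and exact4_arr_mid: "qoperator (E1 S) (E2 S) (arr_mid S)"
    and exact4_arr_out: "qoperator (E2 S) X (arr_out S)"
    and exact4_ker_in: "qker Y (E1 S) (arr_in S) = {qzero Y}"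
    and exact4_ker_mid: "qker (E1 S) (E2 S) (arr_mid S) = arr_in S ` qcar Y"
    and exact4_ker_out: "qker (E2 S) X (arr_out S) = arr_mid S ` qcar (E1 S)"
    and exact4_surj: "arr_out S ` qcar (E2 S) = qcar X"
  using assms unfolding exact4_def by auto

lemma zero4_exact:
  assumes "quasi_banach Y" "quasi_banach X"
  shows "exact4 Y X (zero4 Y X)"
  using assms
  by (auto simp: exact4_def zero4_def qker_def qoperator_id qoperator_const_zero
      image_constant[of "qzero Y"])

lemma arrow4_trans:
  assumes ST: "arrow4 Y X S T" and TU: "arrow4 Y X T U"
  shows "arrow4 Y X S U"
proof -
  obtain u1 u2 where u: "qoperator (E1 S) (E1 T) u1" "qoperator (E2 S) (E2 T) u2" "commutes4 Y S T u1 u2"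
    using ST unfolding arrow4_def by blast
  obtain v1 v2 where v: "qoperator (E1 T) (E1 U) v1" "qoperator (E2 T) (E2 U) v2" "commutes4 Y T U v1 v2"
    using TU unfolding arrow4_def by blast
  have S: "exact4 Y X S" and T: "exact4 Y X T" and U: "exact4 Y X U"
    using ST TU by (auto simp: arrow4_def)
  have "qoperator (E1 S) (E1 U) (\<lambda>x. v1 (u1 x))" "qoperator (E2 S) (E2 U) (\<lambda>x. v2 (u2 x))"
    using exact4_quasi_banach[OF S] exact4_quasi_banach[OF T]
    by (auto intro: qoperator_comp[OF u(1) v(1)] qoperator_comp[OF u(2) v(2)])
  moreover have "commutes4 Y S U (\<lambda>x. v1 (u1 x)) (\<lambda>x. v2 (u2 x))"
    using u(3) v(3) qoperator_in[OF u(1)] qoperator_in[OF u(2)] by (simp add: commutes4_def)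
  ultimately show ?thesis
    using S U unfolding arrow4_def by blast
qed

lemma iso4_arrow4: "iso4 Y X S T \<Longrightarrow> arrow4 Y X S T"
  unfolding iso4_def arrow4_def qiso_def by blast

lemma iso4_arrow4_inverse:
  assumes "iso4 Y X S T"
  shows "arrow4 Y X T S"
proof -
  obtain u1 u2 where u: "qiso (E1 S) (E1 T) u1" "qiso (E2 S) (E2 T) u2" "commutes4 Y S T u1 u2"
    and S: "exact4 Y X S" and T: "exact4 Y X T"
    using assms unfolding iso4_def by blast
  let ?v1 = "inv_into (qcar (E1 S)) u1" and ?v2 = "inv_into (qcar (E2 S)) u2"
  have inv: "\<And>e. e \<in> qcar (E1 S) \<Longrightarrow> ?v1 (u1 e) = e" "\<And>e. e \<in> qcar (E2 S) \<Longrightarrow> ?v2 (u2 e) = e"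
    and onto: "qcar (E1 T) = u1 ` qcar (E1 S)" "qcar (E2 T) = u2 ` qcar (E2 S)"
    using u by (auto simp: qiso_def bij_betw_def)
  have "commutes4 Y T S ?v1 ?v2"
    unfolding commutes4_def onto
  proof (intro conjI ballI)
    show "?v1 (arr_in T y) = arr_in S y" if "y \<in> qcar Y" for y
      using u(3) inv(1)[of "arr_in S y"] that qoperator_in[OF exact4_arr_in[OF S]]
      by (simp add: commutes4_def)
    show "?v2 (arr_mid T e) = arr_mid S (?v1 e)" if "e \<in> u1 ` qcar (E1 S)" for e
      using u(3) inv that qoperator_in[OF exact4_arr_mid[OF S]] by (force simp: commutes4_def)
    show "arr_out S (?v2 e) = arr_out T e" if "e \<in> u2 ` qcar (E2 S)" for e
      using u(3) inv that by (force simp: commutes4_def)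
  qed
  then show ?thesis
    using S T u unfolding arrow4_def qiso_def by blast
qed

definition qcopy :: "('a \<Rightarrow> 'u) \<Rightarrow> ('k, 'a) qspace \<Rightarrow> ('k, 'u) qspace" where
  "qcopy h V =
     (let g = inv_into (qcar V) h
      in \<lparr>qcar = h ` qcar V, qzero = h (qzero V), qadd = (\<lambda>a b. h (qadd V (g a) (g b))),
          qsmul = (\<lambda>c a. h (qsmul V c (g a))), qnorm = (\<lambda>a. qnorm V (g a))\<rparr>)"

lemma qcar_qcopy [simp]: "qcar (qcopy h V) = h ` qcar V"
  and qzero_qcopy [simp]: "qzero (qcopy h V) = h (qzero V)"
  by (simp_all add: qcopy_def Let_def)

lemma qcopy_isometric: "inj_on h (qcar V) \<Longrightarrow> isometric_iso V (qcopy h V) h"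
  by (simp add: isometric_iso_def qlinear_def bij_betw_def qcopy_def Let_def)

lemma qcopy_quasi_banach: "inj_on h (qcar V) \<Longrightarrow> quasi_banach V \<Longrightarrow> quasi_banach (qcopy h V)"
  by (rule quasi_banach_isometric[OF qcopy_isometric]) simp_all

definition copy4 ::
  "('a \<Rightarrow> 'u) \<Rightarrow> ('b \<Rightarrow> 'u) \<Rightarrow> ('k, 'y, 'a, 'b, 'x) four_term \<Rightarrow> ('k, 'y, 'u, 'u, 'x) four_term"
where
  "copy4 h1 h2 S =
     \<lparr>E1 = qcopy h1 (E1 S), E2 = qcopy h2 (E2 S), arr_in = (\<lambda>y. h1 (arr_in S y)),
      arr_mid = (\<lambda>e. h2 (arr_mid S (inv_into (qcar (E1 S)) h1 e))),
      arr_out = (\<lambda>e. arr_out S (inv_into (qcar (E2 S)) h2 e))\<rparr>"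

lemma qker_qcopy_domain:
  assumes "inj_on h (qcar V)"
  shows "qker (qcopy h V) W (\<lambda>e. f (inv_into (qcar V) h e)) = h ` qker V W f"
  using assms by (auto simp: qker_def)

lemma qker_qcopy_codomain:
  assumes "inj_on h (qcar W)" "vspace W" "f ` qcar V \<subseteq> qcar W"
  shows "qker V (qcopy h W) (\<lambda>e. h (f e)) = qker V W f"
  using assms by (auto simp: qker_def image_subset_iff inj_on_eq_iff[OF assms(1)])

lemma copy4_exact:
  assumes S: "exact4 Y X S" and h1: "inj_on h1 (qcar (E1 S))" and h2: "inj_on h2 (qcar (E2 S))"
  shows "exact4 Y X (copy4 h1 h2 S)"
proof -
  note [simp] = exact4_quasi_banach[OF S] qcopy_quasi_banach[OF h1] qcopy_quasi_banach[OF h2]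
  note ops = exact4_arr_in[OF S] exact4_arr_mid[OF S] exact4_arr_out[OF S]
  let ?g1 = "inv_into (qcar (E1 S)) h1" and ?g2 = "inv_into (qcar (E2 S)) h2"
  have copy: "qoperator (E1 S) (qcopy h1 (E1 S)) h1" "qoperator (E2 S) (qcopy h2 (E2 S)) h2"
    and inverse: "qoperator (qcopy h1 (E1 S)) (E1 S) ?g1" "qoperator (qcopy h2 (E2 S)) (E2 S) ?g2"
    using isometric_iso_qiso[OF qcopy_isometric[OF h1]] isometric_iso_qiso[OF qcopy_isometric[OF h2]]
    by (simp_all add: qiso_def)
  have g1: "?g1 ` h1 ` qcar (E1 S) = qcar (E1 S)" and g2: "?g2 ` h2 ` qcar (E2 S) = qcar (E2 S)"
    using h1 h2 by (simp_all add: image_image)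
  have "qoperator Y (qcopy h1 (E1 S)) (\<lambda>y. h1 (arr_in S y))"
    "qoperator (qcopy h1 (E1 S)) (qcopy h2 (E2 S)) (\<lambda>e. h2 (arr_mid S (?g1 e)))"
    "qoperator (qcopy h2 (E2 S)) X (\<lambda>e. arr_out S (?g2 e))"
    using qoperator_comp[OF ops(1) copy(1)] qoperator_comp[OF inverse(2) ops(3)]
      qoperator_comp[OF qoperator_comp[OF inverse(1) ops(2)] copy(2)] by simp_all
  moreover have "qker Y (qcopy h1 (E1 S)) (\<lambda>y. h1 (arr_in S y)) = {qzero Y}"
    using exact4_ker_in[OF S] qoperator_in[OF ops(1)] by (subst qker_qcopy_codomain[OF h1]) auto
  moreover have "qker (qcopy h1 (E1 S)) (qcopy h2 (E2 S)) (\<lambda>e. h2 (arr_mid S (?g1 e)))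
      = (\<lambda>y. h1 (arr_in S y)) ` qcar Y"
    using exact4_ker_mid[OF S] qoperator_in[OF ops(2)]
    by (simp add: qker_qcopy_domain[OF h1, of _ "\<lambda>e. h2 (arr_mid S e)"] qker_qcopy_codomain[OF h2]
        image_subset_iff image_image)
  moreover have "qker (qcopy h2 (E2 S)) X (\<lambda>e. arr_out S (?g2 e))
      = (\<lambda>e. h2 (arr_mid S (?g1 e))) ` qcar (qcopy h1 (E1 S))"
    using exact4_ker_out[OF S] g1 by (simp add: qker_qcopy_domain[OF h2]) (metis image_image)
  moreover have "qcar X = (\<lambda>e. arr_out S (?g2 e)) ` qcar (qcopy h2 (E2 S))"
    using exact4_surj[OF S] g2 by simp (metis image_image)
  ultimately show ?thesis
    by (simp add: exact4_def copy4_def h1 h2)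
qed

lemma copy4_iso4:
  assumes S: "exact4 Y X S" and h1: "inj_on h1 (qcar (E1 S))" and h2: "inj_on h2 (qcar (E2 S))"
  shows "iso4 Y X S (copy4 h1 h2 S)"
proof -
  have "qiso (E1 S) (E1 (copy4 h1 h2 S)) h1" "qiso (E2 S) (E2 (copy4 h1 h2 S)) h2"
    using exact4_quasi_banach[OF S] h1 h2 by (simp_all add: copy4_def isometric_iso_qiso qcopy_isometric)
  moreover have "commutes4 Y S (copy4 h1 h2 S) h1 h2"
    using h1 h2 by (simp add: commutes4_def copy4_def)
  ultimately show ?thesis
    using S copy4_exact[OF assms] by (auto simp: iso4_def)
qed

lemma ext2_trivialI:
  fixes S :: "('k::real_normed_field, 'y, 'a, 'b, 'x) four_term" and R :: "('k, 'y, 'c, 'd, 'x) four_term"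
    and h1 :: "'a \<Rightarrow> 'u" and h2 :: "'b \<Rightarrow> 'u" and h3 :: "'c \<Rightarrow> 'u" and h4 :: "'d \<Rightarrow> 'u"
    and h5 :: "'y \<Rightarrow> 'u" and h6 :: "'x \<Rightarrow> 'u"
  assumes SR: "arrow4 Y X S R" and ZR: "arrow4 Y X (zero4 Y X) R"
    and inj: "inj_on h1 (qcar (E1 S))" "inj_on h2 (qcar (E2 S))" "inj_on h3 (qcar (E1 R))"
      "inj_on h4 (qcar (E2 R))" "inj_on h5 (qcar Y)" "inj_on h6 (qcar X)"
  shows "ext2_trivial TYPE('u) Y X S"
proof -
  have S: "iso4 Y X S (copy4 h1 h2 S)" and R: "iso4 Y X R (copy4 h3 h4 R)"
    and Z: "iso4 Y X (zero4 Y X) (copy4 h5 h6 (zero4 Y X))"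
    using SR ZR inj by (auto intro!: copy4_iso4 simp: arrow4_def zero4_def)
  have "arrow4 Y X (copy4 h1 h2 S) (copy4 h3 h4 R)"
    by (rule arrow4_trans[OF iso4_arrow4_inverse[OF S] arrow4_trans[OF SR iso4_arrow4[OF R]]])
  moreover have "arrow4 Y X (copy4 h5 h6 (zero4 Y X)) (copy4 h3 h4 R)"
    by (rule arrow4_trans[OF iso4_arrow4_inverse[OF Z] arrow4_trans[OF ZR iso4_arrow4[OF R]]])
  ultimately have "equivclp (arrow4 Y X) (copy4 h1 h2 S) (copy4 h5 h6 (zero4 Y X))"
    by (meson equivclp_sym equivclp_trans r_into_equivclp)
  then show ?thesis
    unfolding ext2_trivial_def ext2_equiv_def using S Z by blast
qed

section \<open>Spliced sequences\<close>

lemma splice4_exact: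
  assumes "quasilinear Y E E0 \<Phi>" "quasilinear E X X0 \<Psi>"
  shows "exact4 Y X (splice4 Y E X E0 \<Phi> X0 \<Psi>)"
proof -
  interpret \<Phi>: quasilinear Y E E0 \<Phi> by fact
  interpret \<Psi>: quasilinear E X X0 \<Psi> by fact
  have "qker \<Phi>.Z \<Psi>.Z (\<lambda>a. \<Psi>.inc (Zproj E a)) = qker \<Phi>.Z E (Zproj E)"
    using \<Psi>.Zinc_kernel qoperator_in[OF \<Phi>.Zproj_qoperator] by (auto simp: qker_def)
  moreover have "(\<lambda>a. \<Psi>.inc (Zproj E a)) ` qcar \<Phi>.Z = \<Psi>.inc ` qcar E"
    using \<Phi>.Zproj_surj by (metis image_image)
  ultimately show ?thesis
    by (simp add: exact4_def splice4_def \<Phi>.Zinc_qoperator \<Psi>.Zproj_qoperator \<Phi>.Zinc_kernel \<Phi>.Zproj_kernel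
        \<Psi>.Zproj_kernel \<Psi>.Zproj_surj qoperator_comp[OF \<Phi>.Zproj_qoperator \<Psi>.Zinc_qoperator])
qed

lemma splice4_arrow:
  assumes "quasilinear_morphism Y E E0 \<Phi> Y E' E0' \<Phi>' (\<lambda>y. y) P"
    and "quasilinear_morphism E X X0 \<Psi> E' X X0' \<Psi>' P (\<lambda>x. x)"
  shows "arrow4 Y X (splice4 Y E X E0 \<Phi> X0 \<Psi>) (splice4 Y E' X E0' \<Phi>' X0' \<Psi>')"
proof -
  interpret \<Phi>: quasilinear_morphism Y E E0 \<Phi> Y E' E0' \<Phi>' "\<lambda>y. y" P by fact
  interpret \<Psi>: quasilinear_morphism E X X0 \<Psi> E' X X0' \<Psi>' P "\<lambda>x. x" by fact
  have "commutes4 Y (splice4 Y E X E0 \<Phi> X0 \<Psi>) (splice4 Y E' X E0' \<Phi>' X0' \<Psi>') \<Phi>.Zmap \<Psi>.Zmap"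
    using qoperator_in[OF \<Phi>.dom.Zproj_qoperator]
    by (simp add: commutes4_def splice4_def \<Phi>.Zmap_inc \<Psi>.Zmap_inc \<Phi>.Zproj_Zmap \<Psi>.Zproj_Zmap)
  moreover have "exact4 Y X (splice4 Y E X E0 \<Phi> X0 \<Psi>)" "exact4 Y X (splice4 Y E' X E0' \<Phi>' X0' \<Psi>')"
    by (intro splice4_exact; unfold_locales)+
  ultimately show ?thesis
    using \<Phi>.Zmap_qoperator \<Psi>.Zmap_qoperator by (auto simp: arrow4_def splice4_def)
qed

lemma zero4_arrow_splice4:
  assumes \<Phi>: "quasilinear Y E E0 \<Phi>" and X: "quasi_banach X" and L: "qoperator X E L"
  shows "arrow4 Y X (zero4 Y X) (splice4 Y E X E0 \<Phi> (qcar X) L)"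
proof -
  interpret \<Phi>: quasilinear Y E E0 \<Phi> by fact
  interpret L: quasilinear E X "qcar X" L
    using X L by (intro qoperator_quasilinear) simp_all
  have "commutes4 Y (zero4 Y X) (splice4 Y E X E0 \<Phi> (qcar X) L) \<Phi>.inc (Zsection E X L)"
    using qoperator_zero[OF Zsection_qoperator[OF X _ L]] qoperator_zero[OF L.Zinc_qoperator] X
    by (simp add: commutes4_def zero4_def splice4_def \<Phi>.Zproj_inc Zproj_Zsection[OF X _ L])
  moreover have "exact4 Y X (splice4 Y E X E0 \<Phi> (qcar X) L)"
    by (intro splice4_exact; unfold_locales)
  ultimately show ?thesis
    using \<Phi>.Zinc_qoperator Zsection_qoperator[OF X _ L]
    by (auto simp: arrow4_def zero4_exact) (auto simp: zero4_def splice4_def)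
qed

lemma splice4_trivial:
  fixes Y :: "('k::real_normed_field, 'y) qspace" and E :: "('k, 'e) qspace" and X :: "('k, 'x) qspace"
    and c :: "(nat \<Rightarrow> 'y \<times> 'e) \<Rightarrow> 'u" and d :: "(nat \<Rightarrow> 'e \<times> 'x) \<Rightarrow> 'u"
  assumes \<Phi>: "quasilinear Y E E0 \<Phi>" and \<Psi>: "quasilinear E X X0 \<Psi>"
    and P: "qoperator E E P" "\<And>e. e \<in> E0 \<Longrightarrow> P e \<in> E0" "\<And>e. e \<in> E0 \<Longrightarrow> \<Phi> (P e) = \<Phi> e"
    and L: "qoperator X E L" "\<And>x. x \<in> X0 \<Longrightarrow> P (\<Psi> x) = L x"
    and inj_c: "inj c" and inj_d: "inj d"
  shows "ext2_trivial TYPE('u) Y X (splice4 Y E X E0 \<Phi> X0 \<Psi>)"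
proof -
  interpret \<Phi>: quasilinear Y E E0 \<Phi> by fact
  interpret \<Psi>: quasilinear E X X0 \<Psi> by fact
  interpret L: quasilinear E X "qcar X" L
    using L by (intro qoperator_quasilinear) simp_all
  let ?R = "splice4 Y E X E0 \<Phi> (qcar X) L"
  have "quasilinear_morphism Y E E0 \<Phi> Y E E0 \<Phi> (\<lambda>y. y) P"
    using P by unfold_locales (simp_all add: qoperator_id)
  moreover have "quasilinear_morphism E X X0 \<Psi> E X (qcar X) L P (\<lambda>x. x)"
    using P L by unfold_locales (simp_all add: qoperator_id)
  ultimately have "arrow4 Y X (splice4 Y E X E0 \<Phi> X0 \<Psi>) ?R"
    by (rule splice4_arrow)
  moreover have "arrow4 Y X (zero4 Y X) ?R"
    using L by (intro zero4_arrow_splice4 \<Phi>) simp_all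
  moreover have "inj_on (\<lambda>A. c (crep A)) (qcar \<Phi>.Z)" "inj_on (\<lambda>A. d (crep A)) (qcar \<Psi>.Z)"
    "inj_on (\<lambda>A. d (crep A)) (qcar L.Z)"
    using \<Phi>.inj_on_crep_Zsp \<Psi>.inj_on_crep_Zsp L.inj_on_crep_Zsp inj_c inj_d
    by (auto simp: inj_on_def)
  moreover have "inj (\<lambda>y. c (\<lambda>_. (y, undefined)))" "inj (\<lambda>x. d (\<lambda>_. (undefined, x)))"
    using inj_c inj_d by (auto simp: fun_eq_iff intro!: injI dest!: injD)
  ultimately show ?thesis
    by (intro ext2_trivialI) (auto simp: splice4_def intro: inj_on_subset)
qed

section \<open>The spaces \<open>\<ell>\<^sub>2\<^sup>N\<close> and \<open>\<ell>\<^sub>2\<close>\<close>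

lemma fnorm_nonneg [simp]: "0 \<le> fnorm N v"
  by (simp add: fnorm_def)

lemma fnorm_square: "(fnorm N v)\<^sup>2 = (\<Sum>i<N. (norm (v i))\<^sup>2)"
  by (simp add: fnorm_def L2_set_def sum_nonneg)

lemma fnorm_zero [simp]: "fnorm N (\<lambda>_. 0) = 0"
  by (simp add: fnorm_def L2_set_def)

lemma fnorm_uminus [simp]: "fnorm N (\<lambda>i. - v i) = fnorm N v"
  by (simp add: fnorm_def)

lemma fnorm_add_le: "fnorm N (\<lambda>i. v i + w i) \<le> fnorm N v + fnorm N w"
  unfolding fnorm_def
  by (rule order_trans[OF L2_set_mono L2_set_triangle_ineq]) (auto simp: norm_triangle_ineq)

lemma fnorm_smul: "fnorm N (\<lambda>i. c * v i) = norm c * fnorm N v"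
  by (simp add: fnorm_def norm_mult L2_set_right_distrib)

lemma fnorm_scaleR: "fnorm N (\<lambda>i. t *\<^sub>R v i) = \<bar>t\<bar> * fnorm N v"
  by (simp add: fnorm_def L2_set_right_distrib)

lemma norm_le_fnorm: "i < N \<Longrightarrow> norm (v i) \<le> fnorm N v"
  unfolding fnorm_def by (rule member_le_L2_set) auto

lemma l2_simps [simp]:
  "qzero l2 = (\<lambda>_. 0)" "qadd l2 x y = (\<lambda>n. x n + y n)" "qsmul l2 c x = (\<lambda>n. c * x n)"
  "qdiff l2 x y = (\<lambda>n. x n - y n)"
  by (simp_all add: l2_def qdiff_def)

lemma fnorm_le_l2_norm:
  assumes "x \<in> qcar l2"
  shows "fnorm N x \<le> qnorm l2 x"
  using assms unfolding fnorm_def L2_set_def l2_def by (auto intro: sum_le_suminf)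

lemma l2_normI:
  assumes "\<And>N. fnorm N x \<le> r"
  shows l2_inI: "x \<in> qcar l2" and l2_norm_leI: "qnorm l2 x \<le> r"
proof -
  have r: "0 \<le> r"
    using assms[of 0] by (simp add: fnorm_def)
  have partial: "(\<Sum>i<N. (norm (x i))\<^sup>2) \<le> r\<^sup>2" for N
    using power_mono[OF assms[of N], of 2] by (simp add: fnorm_square)
  then have summable: "summable (\<lambda>n. (norm (x n))\<^sup>2)"
    by (intro summableI_nonneg_bounded[of _ "r\<^sup>2"]) auto
  then show "x \<in> qcar l2"
    by (simp add: l2_def)
  have "(\<Sum>n. (norm (x n))\<^sup>2) \<le> r\<^sup>2"
    using summable partial by (rule suminf_le_const)
  then show "qnorm l2 x \<le> r"
    using r by (simp add: l2_def real_le_lsqrt suminf_nonneg summable)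
qed

lemma l2_dominated:
  assumes y: "y \<in> qcar l2" and dominated: "\<And>n. norm (x n) \<le> norm (y n)"
  shows l2_dominated_in: "x \<in> qcar l2" and l2_dominated_norm: "qnorm l2 x \<le> qnorm l2 y"
proof -
  have "fnorm N x \<le> qnorm l2 y" for N
    using fnorm_le_l2_norm[OF y, of N] L2_set_mono[of "{..<N}" "\<lambda>i. norm (x i)" "\<lambda>i. norm (y i)"] dominated
    by (simp add: fnorm_def)
  then show "x \<in> qcar l2" "qnorm l2 x \<le> qnorm l2 y"
    by (rule l2_normI)+
qed

lemma l2_add:
  assumes "x \<in> qcar l2" "y \<in> qcar l2"
  shows l2_add_in: "(\<lambda>n. x n + y n) \<in> qcar l2"
    and l2_triangle: "qnorm l2 (\<lambda>n. x n + y n) \<le> qnorm l2 x + qnorm l2 y"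
proof -
  have "fnorm N (\<lambda>n. x n + y n) \<le> qnorm l2 x + qnorm l2 y" for N
    by (rule order_trans[OF fnorm_add_le add_mono[OF fnorm_le_l2_norm fnorm_le_l2_norm]]) fact+
  then show "(\<lambda>n. x n + y n) \<in> qcar l2" "qnorm l2 (\<lambda>n. x n + y n) \<le> qnorm l2 x + qnorm l2 y"
    by (rule l2_normI)+
qed

lemma l2_smul:
  assumes "x \<in> qcar l2"
  shows l2_smul_in: "(\<lambda>n. c * x n) \<in> qcar l2"
    and l2_smul_norm: "qnorm l2 (\<lambda>n. c * x n) \<le> norm c * qnorm l2 x"
proof -
  have "fnorm N (\<lambda>n. c * x n) \<le> norm c * qnorm l2 x" for N
    by (simp add: fnorm_smul mult_left_mono fnorm_le_l2_norm assms)
  then show "(\<lambda>n. c * x n) \<in> qcar l2" "qnorm l2 (\<lambda>n. c * x n) \<le> norm c * qnorm l2 x"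
    by (rule l2_normI)+
qed

lemma l2_quasinormed [simp]: "quasinormed (l2 :: ('k::real_normed_field, _) qspace)"
proof (rule quasinormedI)
  show "vspace (l2 :: ('k, _) qspace)"
    unfolding vspace_def by (auto simp: l2_add_in l2_smul_in algebra_simps) (simp add: l2_def)
  fix x y :: "nat \<Rightarrow> 'k" and c
  assume x: "x \<in> qcar l2" and y: "y \<in> qcar l2"
  show "0 \<le> qnorm l2 x"
    using order_trans[OF fnorm_nonneg fnorm_le_l2_norm[OF x]] .
  show "x = qzero l2" if "qnorm l2 x = 0"
  proof -
    have "norm (x n) \<le> 0" for n
      using order_trans[OF norm_le_fnorm fnorm_le_l2_norm[OF x], of n "Suc n"] that by simp
    then show ?thesis
      by (simp add: fun_eq_iff)
  qed
  show "qnorm l2 (qsmul l2 c x) \<le> norm c * qnorm l2 x"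
    by (simp add: l2_smul_norm x)
  show "qnorm l2 (qadd l2 x y) \<le> 1 * (qnorm l2 x + qnorm l2 y)"
    by (simp add: l2_triangle x y)
qed

lemma l2_diff_in: "x \<in> qcar l2 \<Longrightarrow> y \<in> qcar l2 \<Longrightarrow> (\<lambda>n. x n - y n) \<in> qcar l2"
  using vspace_diff[of l2 x y] by simp

lemma l2_qCauchyD:
  assumes s: "qCauchy l2 s" and e: "0 < e"
  obtains N where "\<And>m n k. m \<ge> N \<Longrightarrow> n \<ge> N \<Longrightarrow> fnorm k (\<lambda>i. s m i - s n i) < e"
proof -
  obtain N where N: "\<And>m n. m \<ge> N \<Longrightarrow> n \<ge> N \<Longrightarrow> qnorm l2 (qdiff l2 (s m) (s n)) < e"
    using s e unfolding qCauchy_def by meson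
  have bound: "fnorm k (\<lambda>i. s m i - s n i) \<le> qnorm l2 (qdiff l2 (s m) (s n))" for k m n
    by (simp add: fnorm_le_l2_norm l2_diff_in qCauchy_in[OF s])
  show ?thesis
    by (rule that[OF le_less_trans[OF bound N]])
qed

lemma l2_qCauchy_coordinate:
  assumes "qCauchy l2 s"
  shows "Cauchy (\<lambda>n. s n i)"
proof (rule metric_CauchyI)
  fix e :: real assume "0 < e"
  then obtain N where N: "\<And>m n k. m \<ge> N \<Longrightarrow> n \<ge> N \<Longrightarrow> fnorm k (\<lambda>i. s m i - s n i) < e"
    using l2_qCauchyD[OF assms] by blast
  have "dist (s m i) (s n i) < e" if "m \<ge> N" "n \<ge> N" for m n
    using norm_le_fnorm[of i "Suc i" "\<lambda>i. s m i - s n i"] N[OF that, of "Suc i"] by (simp add: dist_norm)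
  then show "\<exists>N. \<forall>m\<ge>N. \<forall>n\<ge>N. dist (s m i) (s n i) < e"
    by blast
qed

lemma l2_qCauchy_tail_le:
  assumes s: "qCauchy l2 s" and x: "\<And>i. (\<lambda>n. s n i) \<longlonglongrightarrow> x i" and e: "0 < e"
  obtains N where "\<And>m k. m \<ge> N \<Longrightarrow> fnorm k (\<lambda>i. s m i - x i) \<le> e"
proof -
  obtain N where N: "\<And>m n k. m \<ge> N \<Longrightarrow> n \<ge> N \<Longrightarrow> fnorm k (\<lambda>i. s m i - s n i) < e"
    using l2_qCauchyD[OF s e] by blast
  have "fnorm k (\<lambda>i. s m i - x i) \<le> e" if "m \<ge> N" for m k
  proof (rule tendsto_upperbound)
    show "(\<lambda>n. fnorm k (\<lambda>i. s m i - s n i)) \<longlonglongrightarrow> fnorm k (\<lambda>i. s m i - x i)"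
      unfolding fnorm_def L2_set_def by (intro tendsto_intros x)
    show "\<forall>\<^sub>F n in sequentially. fnorm k (\<lambda>i. s m i - s n i) \<le> e"
      using N[OF that] by (auto simp: eventually_sequentially intro: less_imp_le)
  qed simp
  then show ?thesis
    by (rule that)
qed

lemma l2_qCauchy_pointwise_limit:
  assumes s: "qCauchy l2 s" and x: "\<And>i. (\<lambda>n. s n i) \<longlonglongrightarrow> x i"
  shows "qasymp l2 sequentially s (\<lambda>_. x)"
proof -
  note s_in [simp] = qCauchy_in[OF s]
  obtain N where "\<And>k. fnorm k (\<lambda>i. s N i - x i) \<le> 1"
    using l2_qCauchy_tail_le[OF s x, of 1] by (metis order_refl zero_less_one)
  then have "(\<lambda>i. s N i - x i) \<in> qcar l2"
    by (rule l2_inI)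
  then have x_in [simp]: "x \<in> qcar l2"
    using l2_diff_in[of "s N" "\<lambda>i. s N i - x i"] by simp
  have "\<exists>N. \<forall>m\<ge>N. norm (qnorm l2 (qdiff l2 (s m) x)) < e" if "0 < e" for e
  proof -
    obtain N where "\<And>m k. m \<ge> N \<Longrightarrow> fnorm k (\<lambda>i. s m i - x i) \<le> e / 2"
      using l2_qCauchy_tail_le[OF s x, of "e / 2"] \<open>0 < e\<close> by (metis half_gt_zero)
    then have "qnorm l2 (\<lambda>i. s m i - x i) \<le> e / 2" if "m \<ge> N" for m
      using that by (intro l2_norm_leI)
    moreover have "norm (qnorm l2 (\<lambda>i. s m i - x i)) = qnorm l2 (\<lambda>i. s m i - x i)" for m
      by (simp add: l2_diff_in)
    ultimately have "norm (qnorm l2 (qdiff l2 (s m) x)) < e" if "m \<ge> N" for m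
      using that \<open>0 < e\<close> by fastforce
    then show ?thesis
      by blast
  qed
  then show ?thesis
    by (simp add: qasymp_def LIMSEQ_iff)
qed

lemma l2_quasi_banach [simp]: "quasi_banach (l2 :: ('k::{real_normed_field, banach}, _) qspace)"
proof -
  have "\<exists>x. qasymp l2 sequentially s (\<lambda>_. x)" if s: "qCauchy l2 s" for s :: "nat \<Rightarrow> nat \<Rightarrow> 'k"
  proof -
    have "(\<lambda>n. s n i) \<longlonglongrightarrow> lim (\<lambda>n. s n i)" for i
      using Cauchy_convergent[OF l2_qCauchy_coordinate[OF s]] by (simp add: convergent_LIMSEQ_iff)
    then show ?thesis
      using l2_qCauchy_pointwise_limit[OF s, of "\<lambda>i. lim (\<lambda>n. s n i)"] by blast
  qed
  then show ?thesis
    by (simp add: quasi_banach_iff)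
qed

lemma l2_tail_tendsto_0:
  assumes "x \<in> qcar l2"
  shows "(\<lambda>N. qnorm l2 (\<lambda>n. if n < N then 0 else x n)) \<longlonglongrightarrow> 0"
proof -
  let ?f = "\<lambda>n. (norm (x n))\<^sup>2"
  have f: "summable ?f"
    using assms by (simp add: l2_def)
  have "(\<lambda>n. (norm (if n < N then 0 else x n))\<^sup>2) sums (suminf ?f - sum ?f {..<N})" for N
  proof -
    have "(\<lambda>n. ?f n - (if n \<in> {..<N} then ?f n else 0)) sums (suminf ?f - sum ?f {..<N})"
      by (intro sums_diff summable_sums f sums_If_finite_set) simp
    also have "(\<lambda>n. ?f n - (if n \<in> {..<N} then ?f n else 0)) = (\<lambda>n. (norm (if n < N then 0 else x n))\<^sup>2)"
      by auto
    finally show ?thesis .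
  qed
  then have "qnorm l2 (\<lambda>n. if n < N then 0 else x n) = sqrt (suminf ?f - sum ?f {..<N})" for N
    by (simp add: l2_def sums_unique[symmetric])
  moreover have "(\<lambda>N. sqrt (suminf ?f - sum ?f {..<N})) \<longlonglongrightarrow> sqrt (suminf ?f - suminf ?f)"
    by (intro tendsto_intros summable_LIMSEQ f)
  ultimately show ?thesis
    by simp
qed

section \<open>Blocks and triples\<close>

lemma sum_three_blocks:
  fixes f :: "nat \<Rightarrow> 'a::comm_monoid_add"
  shows "sum f {..<3 * m} = (\<Sum>i<m. f i) + (\<Sum>i<m. f (m + i)) + (\<Sum>i<m. f (2 * m + i))"
proof -
  have split: "sum f {..<a + b} = sum f {..<a} + (\<Sum>i<b. f (a + i))" for a b
    by (induction b) (simp_all add: add.assoc)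
  have three: "3 * m = m + m + m"
    by simp
  show ?thesis
    by (simp only: three mult_2 split)
qed

lemma fnorm_blocks:
  "(fnorm (3 * m) v)\<^sup>2 = (fnorm m (block m 0 v))\<^sup>2 + (fnorm m (block m 1 v))\<^sup>2 + (fnorm m (block m 2 v))\<^sup>2"
  unfolding fnorm_square sum_three_blocks by (simp add: block_def)

lemma fnorm_triple:
  "(fnorm (3 * m) (triple m x y z))\<^sup>2 = (fnorm m x)\<^sup>2 + (fnorm m y)\<^sup>2 + (fnorm m z)\<^sup>2"
  unfolding fnorm_square sum_three_blocks by (simp add: triple_def)

lemma block_supp: "m \<le> i \<Longrightarrow> block m k v i = 0"
  by (simp add: block_def)

lemma block_triple:
  assumes "\<And>i. m \<le> i \<Longrightarrow> x i = 0" "\<And>i. m \<le> i \<Longrightarrow> y i = 0"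
  shows "block m 0 (triple m x y z) = x" "block m (Suc 0) (triple m x y z) = y"
  using assms by (auto simp: block_def triple_def fun_eq_iff not_less)

lemma block_add: "block m k (\<lambda>i. v i + w i) = (\<lambda>i. block m k v i + block m k w i :: 'k::monoid_add)"
  by (auto simp: block_def)

lemma block_smul: "block m k (\<lambda>i. c * v i) = (\<lambda>i. c * block m k v i :: 'k::mult_zero)"
  by (auto simp: block_def)

section \<open>The maps \<open>P\<^sub>n\<close> and \<open>\<Gamma>\<^sub>n\<close>\<close>

text \<open>With \<open>P\<^sub>0\<close> and \<open>\<Gamma>\<^sub>0\<close> the identity of the scalars, the recursions hold from \<open>n = 0\<close> on.\<close>

definition elp_block :: "nat \<Rightarrow> nat \<Rightarrow> (nat \<Rightarrow> 'k::real_normed_field) \<Rightarrow> nat \<Rightarrow> 'k" where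
  "elp_block n k v = elp_P n (block (3 ^ n) k v)"

definition elp_plane :: "nat \<Rightarrow> (nat \<Rightarrow> 'k::real_normed_field) \<Rightarrow> real \<times> real" where
  "elp_plane n v = (fnorm (3 ^ n) (elp_block n 0 v), fnorm (3 ^ n) (elp_block n 1 v))"

definition elp_third :: "nat \<Rightarrow> (nat \<Rightarrow> 'k::real_normed_field) \<Rightarrow> nat \<Rightarrow> 'k" where
  "elp_third n v = (\<lambda>i. snd (sgn (elp_plane n v)) *\<^sub>R elp_block n 0 v i)"

lemma elp_P_Suc: "elp_P (Suc n) v = triple (3 ^ n) (elp_block n 0 v) (elp_block n 1 v) (\<lambda>_. 0)"
  by (cases n) (auto simp: elp_block_def Let_def triple_def block_def fun_eq_iff)

lemma snd_sgn_real_pair: "snd (sgn (a, b :: real)) = b / sqrt (a\<^sup>2 + b\<^sup>2)"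
  by (simp add: sgn_prod_def norm_Pair divide_inverse)

lemma elp_G_Suc:
  "elp_G (Suc n) v
    = triple (3 ^ n) (elp_G n (elp_block n 0 v)) (elp_G n (elp_block n 1 v)) (elp_third n v)"
  unfolding elp_third_def elp_plane_def elp_block_def snd_sgn_real_pair
  by (cases n) (auto simp: Let_def triple_def block_def fun_eq_iff fnorm_def L2_set_def)

declare elp_P.simps(2,3) [simp del] elp_G.simps(2,3) [simp del]

lemma elp_P_supp: "(\<And>i. 3 ^ n \<le> i \<Longrightarrow> v i = 0) \<Longrightarrow> 3 ^ n \<le> i \<Longrightarrow> elp_P n v i = 0"
  by (cases n) (auto simp: elp_P_Suc triple_def)

lemma elp_G_supp: "(\<And>i. 3 ^ n \<le> i \<Longrightarrow> v i = 0) \<Longrightarrow> 3 ^ n \<le> i \<Longrightarrow> elp_G n v i = 0"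
  by (cases n) (auto simp: elp_G_Suc triple_def)

lemma elp_block_supp: "3 ^ n \<le> i \<Longrightarrow> elp_block n k v i = 0"
  unfolding elp_block_def by (rule elp_P_supp) (auto simp: block_supp)

lemma elp_G_block_supp: "3 ^ n \<le> i \<Longrightarrow> elp_G n (elp_block n k v) i = 0"
  by (rule elp_G_supp) (auto simp: elp_block_supp)

lemma elp_P_add: "elp_P n (\<lambda>i. v i + w i) = (\<lambda>i. elp_P n v i + elp_P n w i)"
  by (induction n arbitrary: v w) (auto simp: elp_P_Suc elp_block_def block_add triple_def fun_eq_iff)

lemma elp_P_smul: "elp_P n (\<lambda>i. c * v i) = (\<lambda>i. c * elp_P n v i)"
  by (induction n arbitrary: v) (auto simp: elp_P_Suc elp_block_def block_smul triple_def fun_eq_iff)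

lemma elp_P_zero: "elp_P n (\<lambda>_. 0) = (\<lambda>_. 0)"
  using elp_P_smul[of n 0 "\<lambda>_. 0"] by simp

lemma elp_block_add: "elp_block n k (\<lambda>i. v i + w i) = (\<lambda>i. elp_block n k v i + elp_block n k w i)"
  by (simp add: elp_block_def block_add elp_P_add)

lemma elp_block_smul: "elp_block n k (\<lambda>i. c * v i) = (\<lambda>i. c * elp_block n k v i)"
  by (simp add: elp_block_def block_smul elp_P_smul)

lemma elp_plane_smul: "elp_plane n (\<lambda>i. c * v i) = norm c *\<^sub>R elp_plane n v"
  by (simp add: elp_plane_def elp_block_smul fnorm_smul)

lemma elp_third_smul: "c \<noteq> 0 \<Longrightarrow> elp_third n (\<lambda>i. c * v i) = (\<lambda>i. c * elp_third n v i)"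
  by (simp add: elp_third_def elp_plane_smul elp_block_smul sgn_scaleR)

lemma fnorm_elp_P_Suc: "fnorm (3 ^ Suc n) (elp_P (Suc n) v) = norm (elp_plane n v)"
  unfolding elp_plane_def norm_Pair
  by (rule real_sqrt_unique[symmetric]) (simp_all add: elp_P_Suc fnorm_triple)

lemma fnorm_elp_P_le: "fnorm (3 ^ n) (elp_P n v) \<le> fnorm (3 ^ n) v"
proof (induction n arbitrary: v)
  case (Suc n)
  have "(fnorm (3 ^ n) (elp_block n k v))\<^sup>2 \<le> (fnorm (3 ^ n) (block (3 ^ n) k v))\<^sup>2" for k
    unfolding elp_block_def by (intro power_mono Suc fnorm_nonneg)
  from this[of 0] this[of 1] have "(fnorm (3 ^ Suc n) (elp_P (Suc n) v))\<^sup>2 \<le> (fnorm (3 ^ Suc n) v)\<^sup>2"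
    unfolding elp_P_Suc power_Suc fnorm_triple fnorm_blocks[of _ v] by (simp add: add_increasing2 add_mono)
  then show ?case
    by (rule power2_le_imp_le) (rule fnorm_nonneg)
qed simp

lemma norm_elp_plane_le: "norm (elp_plane n v) \<le> fnorm (3 ^ Suc n) v"
  using fnorm_elp_P_le[of "Suc n" v] unfolding fnorm_elp_P_Suc .

lemma elp_block_triple:
  assumes "\<And>i. 3 ^ n \<le> i \<Longrightarrow> x i = 0" "\<And>i. 3 ^ n \<le> i \<Longrightarrow> y i = 0"
  shows "elp_block n 0 (triple (3 ^ n) x y z) = elp_P n x"
    and "elp_block n (Suc 0) (triple (3 ^ n) x y z) = elp_P n y"
  using assms by (simp_all add: elp_block_def block_triple)

lemma elp_P_P: "elp_P n (elp_P n v) = elp_P n v"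
proof (induction n arbitrary: v)
  case (Suc n)
  then have "elp_P n (elp_block n k v) = elp_block n k v" for k
    by (simp add: elp_block_def)
  then show ?case
    by (simp add: elp_P_Suc elp_block_triple elp_block_supp)
qed simp

lemma elp_P_block: "elp_P n (elp_block n k v) = elp_block n k v"
  by (simp add: elp_block_def elp_P_P)

lemma elp_G_P: "elp_G n (elp_P n v) = elp_G n v"
  by (cases n)
    (simp_all add: elp_G_Suc elp_P_Suc elp_third_def elp_plane_def elp_block_triple
      elp_block_supp elp_P_block)

lemma elp_P_G: "elp_P n (elp_G n v) = elp_P n v"
  by (induction n arbitrary: v)
    (simp_all add: elp_G_Suc elp_P_Suc elp_block_triple elp_block_supp elp_G_block_supp elp_P_block)

lemma elp_G_zero: "elp_G n (\<lambda>_. 0) = (\<lambda>_. 0)"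
proof (induction n)
  case (Suc n)
  have "elp_block n k (\<lambda>_. 0) = (\<lambda>_. 0 :: 'a)" for k
    using elp_block_smul[of n k 0 "\<lambda>_. 0"] by simp
  then show ?case
    by (simp add: elp_G_Suc elp_third_def Suc) (simp add: triple_def fun_eq_iff)
qed simp

lemma elp_G_smul: "elp_G n (\<lambda>i. c * v i) = (\<lambda>i. c * elp_G n v i)"
proof (induction n arbitrary: v)
  case (Suc n)
  then show ?case
    by (cases "c = 0")
      (simp_all add: elp_G_zero elp_G_Suc elp_block_smul elp_third_smul triple_def fun_eq_iff)
qed simp

section \<open>Quasilinearity of the maps \<open>\<Gamma>\<^sub>n\<close>\<close>

lemma norm_sgn_diff_square:
  fixes u v :: "'a::real_inner"
  shows "(norm (sgn u - sgn v))\<^sup>2 * (norm u * norm v) = 2 * (norm u * norm v - u \<bullet> v)"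
proof (cases "u = 0 \<or> v = 0")
  case False
  have "(norm (sgn u - sgn v))\<^sup>2 = (norm (sgn u))\<^sup>2 + (norm (sgn v))\<^sup>2 - 2 * (sgn u \<bullet> sgn v)"
    by (simp add: power2_norm_eq_inner inner_diff inner_commute)
  also have "\<dots> = 2 - 2 * (u \<bullet> v) / (norm u * norm v)"
    using False by (simp add: norm_sgn) (simp add: sgn_div_norm field_simps)
  finally show ?thesis
    using False by (simp add: field_simps)
qed auto

lemma snd_sgn_diff_le:
  fixes u v :: "'a::real_inner \<times> 'b::real_inner"
  assumes "norm u \<le> norm v"
  shows "(norm (snd (sgn u) - snd (sgn v)))\<^sup>2 * (norm (fst u))\<^sup>2 \<le> 2 * (norm u * norm v - u \<bullet> v)"
proof -
  have "norm (snd (sgn u) - snd (sgn v)) \<le> norm (sgn u - sgn v)"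
    using norm_snd_le[of "snd (sgn u - sgn v)" "fst (sgn u - sgn v)"]
    unfolding prod.collapse by (simp only: snd_diff)
  moreover have "(norm (fst u))\<^sup>2 \<le> norm u * norm v"
    unfolding power2_eq_square using assms norm_fst_le[of "fst u" "snd u"]
    by (intro mult_mono) (auto intro: order_trans)
  ultimately have "(norm (snd (sgn u) - snd (sgn v)))\<^sup>2 * (norm (fst u))\<^sup>2
      \<le> (norm (sgn u - sgn v))\<^sup>2 * (norm u * norm v)"
    by (intro mult_mono power_mono) auto
  then show ?thesis
    by (simp add: norm_sgn_diff_square)
qed

definition pairwise_inner :: "'a::real_inner \<Rightarrow> 'a \<Rightarrow> 'a \<Rightarrow> real" where
  "pairwise_inner u v w = u \<bullet> v + u \<bullet> w + v \<bullet> w"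

lemma pairwise_inner_prod:
  "pairwise_inner p q r = pairwise_inner (fst p) (fst q) (fst r) + pairwise_inner (snd p) (snd q) (snd r)"
  by (simp add: pairwise_inner_def inner_prod_def)

lemma pairwise_inner_mono:
  fixes a b c a' b' c' :: real
  assumes "0 \<le> a" "0 \<le> b" "0 \<le> c" "a \<le> a'" "b \<le> b'" "c \<le> c'"
  shows "pairwise_inner a b c \<le> pairwise_inner a' b' c'"
  unfolding pairwise_inner_def inner_real_def using assms by (intro add_mono mult_mono) auto

lemma fnorm_sgn_combination_le_max:
  fixes x1 x2 x3 :: "nat \<Rightarrow> 'k::real_normed_field" and p1 p2 p3 :: "real \<times> real"
  assumes zero_sum: "\<And>i. x1 i + x2 i + x3 i = 0"
    and fst_p: "fst p1 = fnorm m x1" "fst p2 = fnorm m x2"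
    and largest: "norm p1 \<le> norm p3" "norm p2 \<le> norm p3"
  shows "(fnorm m (\<lambda>i. snd (sgn p1) *\<^sub>R x1 i + snd (sgn p2) *\<^sub>R x2 i + snd (sgn p3) *\<^sub>R x3 i))\<^sup>2
    \<le> 4 * (pairwise_inner (norm p1) (norm p2) (norm p3) - pairwise_inner p1 p2 p3)"
proof -
  let ?t = "\<lambda>p. snd (sgn p)" and ?gap = "\<lambda>p q. norm p * norm q - p \<bullet> q"
  let ?c1 = "?t p1 - ?t p3" and ?c2 = "?t p2 - ?t p3"
  have "x3 = (\<lambda>i. - x1 i - x2 i)"
    using zero_sum by (simp add: fun_eq_iff algebra_simps add_eq_0_iff)
  then have "fnorm m (\<lambda>i. ?t p1 *\<^sub>R x1 i + ?t p2 *\<^sub>R x2 i + ?t p3 *\<^sub>R x3 i)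
      = fnorm m (\<lambda>i. ?c1 *\<^sub>R x1 i + ?c2 *\<^sub>R x2 i)"
    by (simp add: algebra_simps)
  also have "\<dots> \<le> \<bar>?c1\<bar> * fst p1 + \<bar>?c2\<bar> * fst p2"
    using fnorm_add_le[of m "\<lambda>i. ?c1 *\<^sub>R x1 i" "\<lambda>i. ?c2 *\<^sub>R x2 i"] by (simp add: fnorm_scaleR fst_p)
  finally have "(fnorm m (\<lambda>i. ?t p1 *\<^sub>R x1 i + ?t p2 *\<^sub>R x2 i + ?t p3 *\<^sub>R x3 i))\<^sup>2
      \<le> (\<bar>?c1\<bar> * fst p1 + \<bar>?c2\<bar> * fst p2)\<^sup>2"
    by (intro power_mono) auto
  also have "\<dots> \<le> 2 * (?c1\<^sup>2 * (fst p1)\<^sup>2 + ?c2\<^sup>2 * (fst p2)\<^sup>2)"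
    using sum_squares_bound[of "\<bar>?c1\<bar> * fst p1" "\<bar>?c2\<bar> * fst p2"]
    by (simp add: power2_sum power_mult_distrib mult.commute)
  also have "\<dots> \<le> 4 * (?gap p1 p3 + ?gap p2 p3)"
    using snd_sgn_diff_le[OF largest(1)] snd_sgn_diff_le[OF largest(2)] by simp
  also have "\<dots> \<le> 4 * (pairwise_inner (norm p1) (norm p2) (norm p3) - pairwise_inner p1 p2 p3)"
    using norm_cauchy_schwarz[of p1 p2] by (simp add: pairwise_inner_def)
  finally show ?thesis .
qed

lemma fnorm_sgn_combination_le:
  fixes x1 x2 x3 :: "nat \<Rightarrow> 'k::real_normed_field" and p1 p2 p3 :: "real \<times> real"
  assumes zero_sum: "\<And>i. x1 i + x2 i + x3 i = 0"
    and fst_p: "fst p1 = fnorm m x1" "fst p2 = fnorm m x2" "fst p3 = fnorm m x3"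
  shows "(fnorm m (\<lambda>i. snd (sgn p1) *\<^sub>R x1 i + snd (sgn p2) *\<^sub>R x2 i + snd (sgn p3) *\<^sub>R x3 i))\<^sup>2
    \<le> 4 * (pairwise_inner (norm p1) (norm p2) (norm p3) - pairwise_inner p1 p2 p3)"
proof -
  note symmetric = pairwise_inner_def inner_commute mult.commute add_ac
  consider (largest_p3) "norm p1 \<le> norm p3" "norm p2 \<le> norm p3"
    | (largest_p2) "norm p1 \<le> norm p2" "norm p3 \<le> norm p2"
    | (largest_p1) "norm p2 \<le> norm p1" "norm p3 \<le> norm p1"
    by linarith
  then show ?thesis
  proof cases
    case largest_p3
    then show ?thesis
      using fnorm_sgn_combination_le_max[of x1 x2 x3 p1 m p2 p3] assms by blast
  next
    case largest_p2
    then show ?thesis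
      using fnorm_sgn_combination_le_max[of x1 x3 x2 p1 m p3 p2] assms by (simp add: symmetric)
  next
    case largest_p1
    then show ?thesis
      using fnorm_sgn_combination_le_max[of x3 x2 x1 p3 m p2 p1] assms by (simp add: symmetric)
  qed
qed

definition elp_defect :: "nat \<Rightarrow> (nat \<Rightarrow> 'k::real_normed_field) \<Rightarrow> (nat \<Rightarrow> 'k) \<Rightarrow> nat \<Rightarrow> 'k" where
  "elp_defect n v w = (\<lambda>i. elp_G n (\<lambda>i. v i + w i) i - (elp_G n v i + elp_G n w i))"

lemma elp_defect_Suc:
  "elp_defect (Suc n) v w = triple (3 ^ n)
     (elp_defect n (elp_block n 0 v) (elp_block n 0 w)) (elp_defect n (elp_block n 1 v) (elp_block n 1 w))
     (\<lambda>i. elp_third n (\<lambda>i. v i + w i) i - (elp_third n v i + elp_third n w i))"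
  unfolding elp_defect_def elp_G_Suc elp_block_add by (simp add: triple_def fun_eq_iff)

lemma fnorm_elp_third_defect_square_le:
  fixes v w :: "nat \<Rightarrow> 'k::real_normed_field"
  defines "s \<equiv> \<lambda>i. v i + w i"
  shows "(fnorm (3 ^ n) (\<lambda>i. elp_third n s i - (elp_third n v i + elp_third n w i)))\<^sup>2
    \<le> 4 * (pairwise_inner (norm (elp_plane n v)) (norm (elp_plane n w)) (norm (elp_plane n s))
         - pairwise_inner (elp_plane n v) (elp_plane n w) (elp_plane n s))"
proof -
  let ?x = "elp_block n 0" and ?t = "\<lambda>u. snd (sgn (elp_plane n u))"
  have "?x v i + ?x w i + - ?x s i = 0" for i
    by (simp add: s_def elp_block_add)
  moreover have "fst (elp_plane n u) = fnorm (3 ^ n) (?x u)" for u :: "nat \<Rightarrow> 'k"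
    by (simp add: elp_plane_def)
  ultimately have "(fnorm (3 ^ n) (\<lambda>i. ?t v *\<^sub>R ?x v i + ?t w *\<^sub>R ?x w i + ?t s *\<^sub>R - ?x s i))\<^sup>2
      \<le> 4 * (pairwise_inner (norm (elp_plane n v)) (norm (elp_plane n w)) (norm (elp_plane n s))
         - pairwise_inner (elp_plane n v) (elp_plane n w) (elp_plane n s))"
    by (intro fnorm_sgn_combination_le) simp_all
  then show ?thesis
    by (subst (asm) fnorm_uminus[symmetric]) (simp add: elp_third_def)
qed

lemma fnorm_elp_defect_square_le:
  "(fnorm (3 ^ n) (elp_defect n v w))\<^sup>2
    \<le> 4 * pairwise_inner (fnorm (3 ^ n) v) (fnorm (3 ^ n) w) (fnorm (3 ^ n) (\<lambda>i. v i + w i))"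
proof (induction n arbitrary: v w)
  case 0
  have "elp_defect 0 v w = (\<lambda>_. 0)"
    by (simp add: elp_defect_def)
  then show ?case
    by (simp add: pairwise_inner_def)
next
  case (Suc n)
  let ?s = "\<lambda>i. v i + w i" and ?p = "elp_plane n"
  let ?norms = "pairwise_inner (norm (?p v)) (norm (?p w)) (norm (?p ?s))"
  have component: "(fnorm (3 ^ n) (elp_defect n (elp_block n k v) (elp_block n k w)))\<^sup>2
      \<le> 4 * pairwise_inner (fnorm (3 ^ n) (elp_block n k v)) (fnorm (3 ^ n) (elp_block n k w))
            (fnorm (3 ^ n) (elp_block n k ?s))" for k
    using Suc[of "elp_block n k v" "elp_block n k w"] by (simp add: elp_block_add)
  have "(fnorm (3 ^ Suc n) (elp_defect (Suc n) v w))\<^sup>2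
      \<le> 4 * pairwise_inner (fst (?p v)) (fst (?p w)) (fst (?p ?s))
        + 4 * pairwise_inner (snd (?p v)) (snd (?p w)) (snd (?p ?s))
        + 4 * (?norms - pairwise_inner (?p v) (?p w) (?p ?s))"
    unfolding elp_defect_Suc power_Suc fnorm_triple
    using component[of 0] component[of 1]
    by (intro add_mono fnorm_elp_third_defect_square_le) (simp_all add: elp_plane_def)
  also have "\<dots> = 4 * ?norms"
    by (simp add: pairwise_inner_prod)
  also have "\<dots> \<le> 4 * pairwise_inner (fnorm (3 ^ Suc n) v) (fnorm (3 ^ Suc n) w) (fnorm (3 ^ Suc n) ?s)"
    by (intro mult_left_mono pairwise_inner_mono norm_elp_plane_le) simp_all
  finally show ?case .
qed

lemma fnorm_elp_defect_le: "fnorm (3 ^ n) (elp_defect n v w) \<le> 3 * (fnorm (3 ^ n) v + fnorm (3 ^ n) w)"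
proof (rule power2_le_imp_le)
  let ?a = "fnorm (3 ^ n) v" and ?b = "fnorm (3 ^ n) w"
  have "(fnorm (3 ^ n) (elp_defect n v w))\<^sup>2 \<le> 4 * pairwise_inner ?a ?b (?a + ?b)"
    by (rule order_trans[OF fnorm_elp_defect_square_le])
      (intro mult_left_mono pairwise_inner_mono fnorm_add_le; simp)
  also have "\<dots> \<le> (3 * (?a + ?b))\<^sup>2"
    by (simp add: pairwise_inner_def power2_eq_square algebra_simps)
  finally show "(fnorm (3 ^ n) (elp_defect n v w))\<^sup>2 \<le> (3 * (?a + ?b))\<^sup>2" .
qed simp

section \<open>The Enflo--Lindenstrauss--Pisier map\<close>

definition block_norms :: "(nat \<Rightarrow> nat \<Rightarrow> 'k::real_normed_field) \<Rightarrow> nat \<Rightarrow> real" where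
  "block_norms v n = fnorm (3 ^ n) (v n)"

lemma elp_space_simps [simp]:
  "qzero elp_space = (\<lambda>_ _. 0)" "qadd elp_space v w = (\<lambda>n i. v n i + w n i)"
  "qsmul elp_space c v = (\<lambda>n i. c * v n i)"
  "qdiff elp_space v w = (\<lambda>n i. v n i - w n i)"
  "qnorm elp_space v = qnorm l2 (block_norms v)"
  by (simp_all add: elp_space_def l2_def qdiff_def block_norms_def)

lemma elp_space_in_iff:
  "v \<in> qcar elp_space \<longleftrightarrow>
     (\<forall>i. v 0 i = 0) \<and> (\<forall>n i. 3 ^ n \<le> i \<longrightarrow> v n i = 0) \<and> block_norms v \<in> qcar l2"
  by (simp add: elp_space_def l2_def block_norms_def)

lemma elp_space_vspace: "vspace (elp_space :: ('k::real_normed_field, _) qspace)"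
proof -
  have "block_norms (\<lambda>n i. v n i + w n i) \<in> qcar l2"
    if "block_norms v \<in> qcar l2" "block_norms w \<in> qcar l2" for v w :: "nat \<Rightarrow> nat \<Rightarrow> 'k"
    by (rule l2_dominated_in[OF l2_add_in[OF that]]) (simp add: block_norms_def fnorm_add_le)
  moreover have "block_norms (\<lambda>n i. c * v n i) = (\<lambda>n. norm c * block_norms v n)"
    for c and v :: "nat \<Rightarrow> nat \<Rightarrow> 'k"
    by (simp add: block_norms_def fnorm_smul fun_eq_iff)
  moreover have "block_norms (\<lambda>_ _. 0 :: 'k) \<in> qcar l2"
    by (simp add: block_norms_def[abs_def] l2_def)
  ultimately show ?thesis
    unfolding vspace_def by (auto simp: elp_space_in_iff l2_smul_in algebra_simps)
qed

lemma elp_space_quasi_banach: "quasi_banach (elp_space :: ('k::{real_normed_field, banach}, _) qspace)"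
proof -
  obtain T :: "(nat \<Rightarrow> nat \<Rightarrow> 'k) \<Rightarrow> nat \<Rightarrow> 'k" where T: "isometric_iso elp_space l2 T"
    using elp_space_isometric_l2 by blast
  note inverse = isometric_iso_inverse[OF T elp_space_vspace]
  show ?thesis
    using qoperator_zero[OF isometric_iso_qoperator[OF inverse] _ elp_space_vspace]
    by (intro quasi_banach_isometric[OF inverse]) simp_all
qed

lemma elp_space0_in: "v \<in> elp_space0 \<Longrightarrow> v \<in> qcar elp_space"
  by (simp add: elp_space0_def)

lemma elp_space0_iff:
  "v \<in> elp_space0 \<longleftrightarrow>
     (\<forall>i. v 0 i = 0) \<and> (\<forall>n i. 3 ^ n \<le> i \<longrightarrow> v n i = 0) \<and> finite {n. v n \<noteq> (\<lambda>_. 0)}"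
proof -
  have "block_norms v \<in> qcar l2" if "finite {n. v n \<noteq> (\<lambda>_. 0)}"
    using summable_finite[OF that, of "\<lambda>n. (norm (block_norms v n))\<^sup>2"]
    by (simp add: l2_def block_norms_def)
  then show ?thesis
    by (auto simp: elp_space0_def elp_space_in_iff)
qed

lemma elp_space0_add:
  assumes "v \<in> elp_space0" "w \<in> elp_space0"
  shows "(\<lambda>n i. v n i + w n i) \<in> elp_space0"
proof -
  have "{n. (\<lambda>i. v n i + w n i) \<noteq> (\<lambda>_. 0)} \<subseteq> {n. v n \<noteq> (\<lambda>_. 0)} \<union> {n. w n \<noteq> (\<lambda>_. 0)}"
    by auto
  then show ?thesis
    using assms by (auto simp: elp_space0_iff intro: finite_subset)
qed

lemma elp_space0_blockwise:
  assumes v: "v \<in> elp_space0" and zero: "\<And>n. f n (\<lambda>_. 0) = (\<lambda>_. 0)"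
    and supp: "\<And>n i. 3 ^ n \<le> i \<Longrightarrow> f n (v n) i = 0"
  shows "(\<lambda>n. f n (v n)) \<in> elp_space0"
proof -
  have "{n. f n (v n) \<noteq> (\<lambda>_. 0)} \<subseteq> {n. v n \<noteq> (\<lambda>_. 0)}"
    using zero by auto
  moreover have "v 0 = (\<lambda>_. 0)"
    using v by (auto simp: elp_space0_iff)
  ultimately show ?thesis
    using v zero supp by (auto simp: elp_space0_iff intro: finite_subset)
qed

lemma elp_space0_smul: "v \<in> elp_space0 \<Longrightarrow> (\<lambda>n i. c * v n i) \<in> elp_space0"
  by (rule elp_space0_blockwise[where f = "\<lambda>_ u i. c * u i"]) (auto simp: elp_space0_iff)

lemma elp_map_smul: "elp_map (\<lambda>n i. c * v n i) = (\<lambda>n i. c * elp_map v n i)"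
  by (simp add: elp_map_def elp_G_smul)

lemma elp_map_in: "v \<in> elp_space0 \<Longrightarrow> elp_map v \<in> elp_space0"
  unfolding elp_map_def
  by (rule elp_space0_blockwise) (auto simp: elp_G_zero elp_space0_iff intro: elp_G_supp)

lemma elp_space0_dense:
  assumes v: "v \<in> qcar elp_space"
  shows "\<exists>s. range s \<subseteq> elp_space0 \<and> qasymp elp_space sequentially s (\<lambda>_. v)"
proof -
  define s where "s N n = (if n < N then v n else (\<lambda>_. 0))" for N n
  have s: "s N \<in> elp_space0" for N
  proof -
    have "{n. s N n \<noteq> (\<lambda>_. 0)} \<subseteq> {..<N}"
      by (auto simp: s_def)
    then show ?thesis
      using v finite_subset by (fastforce simp: elp_space0_iff elp_space_in_iff s_def)
  qed
  have "block_norms (qdiff elp_space (s N) v) = (\<lambda>n. if n < N then 0 else block_norms v n)" for N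
    by (auto simp: block_norms_def s_def)
  then have "(\<lambda>N. qnorm elp_space (qdiff elp_space (s N) v)) \<longlonglongrightarrow> 0"
    using v l2_tail_tendsto_0[of "block_norms v"] by (simp add: elp_space_in_iff del: elp_space_simps(4))
  then show ?thesis
    using s v by (intro exI[of _ s]) (auto simp: qasymp_def elp_space0_in)
qed

lemma elp_map_quasiadditive:
  assumes v: "v \<in> qcar elp_space" and w: "w \<in> qcar elp_space"
  shows "qnorm elp_space (qdiff elp_space (elp_map (qadd elp_space v w))
        (qadd elp_space (elp_map v) (elp_map w)))
    \<le> 3 * (qnorm elp_space v + qnorm elp_space w)"
proof -
  have norms: "block_norms v \<in> qcar l2" "block_norms w \<in> qcar l2"
    using v w by (simp_all add: elp_space_in_iff)
  let ?defect = "block_norms (\<lambda>n. elp_defect n (v n) (w n))"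
  have "norm (?defect n) \<le> norm (3 * (block_norms v n + block_norms w n))" for n
    using fnorm_elp_defect_le[of n "v n" "w n"] by (simp add: block_norms_def)
  then have "qnorm l2 ?defect \<le> qnorm l2 (\<lambda>n. 3 * (block_norms v n + block_norms w n))"
    by (rule l2_dominated_norm[OF l2_smul_in[OF l2_add_in[OF norms]]])
  also have "\<dots> \<le> 3 * qnorm l2 (\<lambda>n. block_norms v n + block_norms w n)"
    using l2_smul_norm[OF l2_add_in[OF norms], of 3] by simp
  also have "\<dots> \<le> 3 * (qnorm l2 (block_norms v) + qnorm l2 (block_norms w))"
    by (intro mult_left_mono l2_triangle norms) simp
  finally show ?thesis
    by (simp add: elp_map_def elp_defect_def)
qed

lemma elp_map_quasilinear:
  "quasilinear elp_space (elp_space :: ('k::{real_normed_field, banach}, _) qspace) elp_space0 elp_map"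
proof
  show "\<exists>Q. \<forall>v\<in>elp_space0. \<forall>w\<in>elp_space0.
      qnorm elp_space (qdiff elp_space (elp_map (qadd elp_space v w))
        (qadd elp_space (elp_map v) (elp_map w)))
      \<le> Q * (qnorm elp_space v + qnorm elp_space w)"
    using elp_map_quasiadditive elp_space0_in by blast
  show "qzero elp_space \<in> elp_space0"
    by (simp add: elp_space0_iff)
qed (auto simp: elp_space_quasi_banach elp_space0_in elp_space0_add elp_space0_smul elp_space0_dense
    elp_map_in elp_map_smul)

definition elp_proj :: "(nat \<Rightarrow> nat \<Rightarrow> 'k) \<Rightarrow> nat \<Rightarrow> nat \<Rightarrow> 'k::real_normed_field" where
  "elp_proj v = (\<lambda>n. elp_P n (v n))"

lemma elp_proj_in0: "v \<in> elp_space0 \<Longrightarrow> elp_proj v \<in> elp_space0"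
  unfolding elp_proj_def
  by (rule elp_space0_blockwise) (auto simp: elp_P_zero elp_space0_iff intro: elp_P_supp)

lemma elp_map_proj: "elp_map (elp_proj v) = elp_map v"
  by (simp add: elp_map_def elp_proj_def elp_G_P)

lemma elp_proj_map: "elp_proj (elp_map v) = elp_proj v"
  by (simp add: elp_map_def elp_proj_def elp_P_G)

lemma elp_proj_qoperator: "qoperator elp_space elp_space elp_proj"
proof (rule qoperatorI)
  fix v :: "nat \<Rightarrow> nat \<Rightarrow> 'a" assume v: "v \<in> qcar elp_space"
  have dominated: "norm (block_norms (elp_proj v) n) \<le> norm (block_norms v n)" for n
    by (simp add: block_norms_def elp_proj_def fnorm_elp_P_le)
  have norms: "block_norms v \<in> qcar l2"
    using v by (simp add: elp_space_in_iff)
  show "elp_proj v \<in> qcar elp_space"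
    using v l2_dominated_in[OF norms dominated]
    by (auto simp: elp_space_in_iff elp_proj_def intro: elp_P_supp)
  show "qnorm elp_space (elp_proj v) \<le> 1 * qnorm elp_space v"
    using l2_dominated_norm[OF norms dominated] by simp
qed (simp_all add: elp_proj_def elp_P_add elp_P_smul)

definition elp_proj_l2 ::
  "((nat \<Rightarrow> nat \<Rightarrow> 'k) \<Rightarrow> nat \<Rightarrow> 'k) \<Rightarrow> (nat \<Rightarrow> 'k) \<Rightarrow> nat \<Rightarrow> 'k::real_normed_field"
where
  "elp_proj_l2 T x = T (elp_proj (inv_into (qcar elp_space) T x))"

context
  fixes T :: "(nat \<Rightarrow> nat \<Rightarrow> 'k::{real_normed_field, banach}) \<Rightarrow> nat \<Rightarrow> 'k"
  assumes T: "isometric_iso elp_space l2 T"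
begin

lemma elp_l2_quasilinear: "quasilinear l2 l2 (elp_dom T) (elp_l2 T)"
  using quasilinear_isometric[OF elp_map_quasilinear T T]
  by (simp add: elp_dom_def elp_l2_def[abs_def])

lemma elp_proj_l2_qoperator: "qoperator l2 l2 (elp_proj_l2 T)"
proof -
  note inverse = isometric_iso_qoperator[OF isometric_iso_inverse[OF T elp_space_vspace]]
  note [simp] = elp_space_quasi_banach
  show ?thesis
    unfolding elp_proj_l2_def[abs_def]
    using qoperator_comp[OF qoperator_comp[OF inverse elp_proj_qoperator] isometric_iso_qoperator[OF T]]
    by simp
qed

lemma
  assumes "x \<in> elp_dom T"
  shows elp_proj_l2_dom: "elp_proj_l2 T x \<in> elp_dom T"
    and elp_l2_proj: "elp_l2 T (elp_proj_l2 T x) = elp_l2 T x"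
    and elp_proj_elp_l2: "elp_proj_l2 T (elp_l2 T x) = elp_proj_l2 T x"
proof -
  obtain v where v: "v \<in> elp_space0" "x = T v"
    using assms by (auto simp: elp_dom_def)
  have [simp]: "inv_into (qcar elp_space) T (T w) = w" if "w \<in> elp_space0" for w
    by (rule isometric_iso_inv[OF T elp_space0_in[OF that]])
  show "elp_proj_l2 T x \<in> elp_dom T" "elp_l2 T (elp_proj_l2 T x) = elp_l2 T x"
    "elp_proj_l2 T (elp_l2 T x) = elp_proj_l2 T x"
    using v by (simp_all add: elp_proj_l2_def elp_l2_def elp_dom_def elp_proj_in0 elp_map_in
        elp_map_proj elp_proj_map)
qed

end

section \<open>The composition \<open>\<Gamma> \<Gamma>\<close>\<close>

definition flatten :: "(nat \<Rightarrow> (nat \<Rightarrow> 'k) \<times> (nat \<Rightarrow> 'k)) \<Rightarrow> nat \<Rightarrow> 'k" where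
  "flatten s n = (case from_nat n of (m, Inl i) \<Rightarrow> fst (s m) i | (m, Inr i) \<Rightarrow> snd (s m) i)"

lemma inj_flatten: "inj flatten"
proof (rule injI)
  fix s t :: "nat \<Rightarrow> (nat \<Rightarrow> 'k) \<times> (nat \<Rightarrow> 'k)" assume eq: "flatten s = flatten t"
  have "fst (s m) i = fst (t m) i" "snd (s m) i = snd (t m) i" for m i :: nat
    using fun_cong[OF eq, of "to_nat (m, Inl i :: nat + nat)"]
      fun_cong[OF eq, of "to_nat (m, Inr i :: nat + nat)"] by (simp_all add: flatten_def)
  then show "s = t"
    by (simp add: fun_eq_iff prod_eq_iff)
qed

theorem proposition5p5:
  fixes T :: "(nat \<Rightarrow> nat \<Rightarrow> 'k::{real_normed_field, banach}) \<Rightarrow> nat \<Rightarrow> 'k"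
    and j :: "(nat \<Rightarrow> 'k) \<Rightarrow> 'u"
  assumes identification: "isometric_iso elp_space l2 T"
    and universe: "inj j"
  shows "ext2_trivial TYPE('u) l2 l2
           (splice4 l2 l2 l2 (elp_dom T) (elp_l2 T) (elp_dom T) (elp_l2 T))"
proof -
  have quasilinear: "quasilinear l2 l2 (elp_dom T) (elp_l2 T)"
    by (rule elp_l2_quasilinear[OF identification])
  have projection: "qoperator l2 l2 (elp_proj_l2 T)"
    by (rule elp_proj_l2_qoperator[OF identification])
  have absorption: "elp_proj_l2 T x \<in> elp_dom T" "elp_l2 T (elp_proj_l2 T x) = elp_l2 T x"
    "elp_proj_l2 T (elp_l2 T x) = elp_proj_l2 T x" if "x \<in> elp_dom T" for x
    using elp_proj_l2_dom elp_l2_proj elp_proj_elp_l2 identification that by blast+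
  have encoding: "inj (j \<circ> flatten)"
    by (rule inj_compose[OF universe inj_flatten])
  show ?thesis
    by (rule splice4_trivial[OF quasilinear quasilinear projection absorption(1,2) projection absorption(3)
          encoding encoding])
qed

end
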